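(* Let $v(x,t)$ be a classical solution on $\mathbb{T}^3$, on a time interval $[0,T)$, of the incompressible Euler equations $$\frac{\partial v}{\partial t}+(v\cdot\nabla)v=-\nabla p,\qquad \operatorname{div} v=0,\qquad v(x,0)=v_0(x),$$ and let $\lambda_1(x,t),\lambda_2(x,t),\lambda_3(x,t)$ be the eigenvalues of its deformation tensor $S=(S_{ij})_{i,j=1}^3$, $S_{ij}=\frac12\left(\frac{\partial v_j}{\partial x_i}+\frac{\partial v_i}{\partial x_j}\right)$. Then $$\frac{d}{dt}\int_{\mathbb{T}^3}(\lambda_1^2+\lambda_2^2+\lambda_3^2)\,dx=-4\int_{\mathbb{T}^3}\lambda_1\lambda_2\lambda_3\,dx$$ on the time interval of existence of the solution.
   Context: $\mathbb{T}^3$ is the 3D periodic box (all functions are periodic in space). $v=(v_1,v_2,v_3)$ is the velocity, $p$ the scalar pressure, $v_0$ the initial velocity with $\operatorname{div} v_0=0$. For a nonnegative integer $m$, $\mathbb{H}^m_\sigma=\{u\in[H^m(\mathbb{T}^3)]^3 : \operatorname{div} u=0\}$, where $H^m(\mathbb{T}^3)$ is the standard $L^2$-based Sobolev space. A classical solution on $[0,T)$ means a solution $v\in C([0,T);\mathbb{H}^m_\sigma)$ with $m>5/2$; such solutions exist locally in time and are unique for $v_0\in\mathbb{H}^m_\sigma$. *)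

theory Defs
  imports "HOL-Analysis.Analysis"
begin

text \<open>
  The torus is the periodic box of side \<open>L > 0\<close>: functions on it are the functions on the whole space
  that have period \<open>L\<close> in each coordinate, and integrals are taken over one period cell.
\<close>

definition cell :: "real \<Rightarrow> (real^3) set" where
  "cell L = cbox 0 (\<chi> i. L)"

definition periodic :: "real \<Rightarrow> (real^3 \<Rightarrow> 'a) \<Rightarrow> bool" where
  "periodic L f \<longleftrightarrow> (\<forall>x i. f (x + axis i L) = f x)"

definition pd :: "3 \<Rightarrow> (real^3 \<Rightarrow> real) \<Rightarrow> real^3 \<Rightarrow> real" where
  "pd i f x = frechet_derivative f (at x) (axis i 1)"

text \<open>A list \<open>[i\<^sub>1, \<dots>, i\<^sub>n]\<close> of indices stands for the derivative of order \<open>n\<close> in these directions.\<close>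

primrec iter_pd :: "3 list \<Rightarrow> (real^3 \<Rightarrow> real) \<Rightarrow> real^3 \<Rightarrow> real" where
  "iter_pd [] f = f"
| "iter_pd (i # js) f = pd i (iter_pd js f)"

definition test_function :: "real \<Rightarrow> (real^3 \<Rightarrow> real) \<Rightarrow> bool" where
  "test_function L \<phi> \<longleftrightarrow> periodic L \<phi> \<and> (\<forall>js x. iter_pd js \<phi> differentiable at x)"

definition L2_per :: "real \<Rightarrow> (real^3 \<Rightarrow> real) \<Rightarrow> bool" where
  "L2_per L u \<longleftrightarrow> periodic L u \<and> u \<in> borel_measurable lebesgue
     \<and> set_integrable lebesgue (cell L) (\<lambda>x. (u x)\<^sup>2)"

definition weak_derivative ::
  "real \<Rightarrow> 3 list \<Rightarrow> (real^3 \<Rightarrow> real) \<Rightarrow> (real^3 \<Rightarrow> real) \<Rightarrow> bool" where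
  "weak_derivative L js u w \<longleftrightarrow> L2_per L w \<and>
     (\<forall>\<phi>. test_function L \<phi> \<longrightarrow>
        (LINT x:cell L|lebesgue. u x * iter_pd js \<phi> x)
          = (- 1) ^ length js * (LINT x:cell L|lebesgue. w x * \<phi> x))"

definition sobolev :: "real \<Rightarrow> nat \<Rightarrow> (real^3 \<Rightarrow> real) set" where
  "sobolev L m = {u. L2_per L u \<and> (\<forall>js. length js \<le> m \<longrightarrow> (\<exists>w. weak_derivative L js u w))}"

text \<open>
  The weak derivative is unique only almost everywhere, and the norm below does not depend on the
  representative. Summing over index lists instead of multi-indices counts each mixed derivative
  with its multinomial multiplicity, so the squared norm is the sum of the squared \<open>L\<^sup>2\<close> norms of
  the derivative tensors of order at most \<open>m\<close>.
\<close>

definition wd :: "real \<Rightarrow> 3 list \<Rightarrow> (real^3 \<Rightarrow> real) \<Rightarrow> real^3 \<Rightarrow> real" where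
  "wd L js u = (SOME w. weak_derivative L js u w)"

definition sobolev_norm :: "real \<Rightarrow> nat \<Rightarrow> (real^3 \<Rightarrow> real^3) \<Rightarrow> real" where
  "sobolev_norm L m u =
     sqrt (\<Sum>j\<in>UNIV. \<Sum>js | length js \<le> m. LINT x:cell L|lebesgue. (wd L js (\<lambda>y. u y $ j) x)\<^sup>2)"

definition sobolev_sigma :: "real \<Rightarrow> nat \<Rightarrow> (real^3 \<Rightarrow> real^3) set" where
  "sobolev_sigma L m =
     {u. (\<forall>j. (\<lambda>x. u x $ j) \<in> sobolev L m) \<and>
         (\<forall>\<phi>. test_function L \<phi> \<longrightarrow>
            (LINT x:cell L|lebesgue. (\<Sum>j\<in>UNIV. u x $ j * pd j \<phi> x)) = 0)}"

definition sobolev_continuous ::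
  "real \<Rightarrow> nat \<Rightarrow> real \<Rightarrow> (real \<Rightarrow> real^3 \<Rightarrow> real^3) \<Rightarrow> bool" where
  "sobolev_continuous L m T v \<longleftrightarrow>
     (\<forall>t\<in>{0..<T}. v t \<in> sobolev_sigma L m) \<and>
     (\<forall>t\<in>{0..<T}. ((\<lambda>s. sobolev_norm L m (\<lambda>x. v s x - v t x)) \<longlongrightarrow> 0) (at t within {0..<T}))"

definition grad :: "(real^3 \<Rightarrow> real) \<Rightarrow> real^3 \<Rightarrow> real^3" where
  "grad f x = (\<chi> i. pd i f x)"

definition divergence :: "(real^3 \<Rightarrow> real^3) \<Rightarrow> real^3 \<Rightarrow> real" where
  "divergence u x = (\<Sum>i\<in>UNIV. pd i (\<lambda>y. u y $ i) x)"

definition advection :: "(real^3 \<Rightarrow> real^3) \<Rightarrow> real^3 \<Rightarrow> real^3" where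
  "advection u x = (\<chi> j. \<Sum>i\<in>UNIV. u x $ i * pd i (\<lambda>y. u y $ j) x)"

text \<open>The time derivative at \<open>t = 0\<close> is the one-sided one.\<close>

definition time_derivative ::
  "real \<Rightarrow> (real \<Rightarrow> real^3 \<Rightarrow> real^3) \<Rightarrow> real \<Rightarrow> real^3 \<Rightarrow> real^3" where
  "time_derivative T v t x = vector_derivative (\<lambda>s. v s x) (at t within {0..<T})"

text \<open>
  The equations hold pointwise, for the (unique) continuous representative of the velocity in
  the Sobolev space, and the time derivative is continuous, as usual for a classical solution.
  Spatial regularity of the velocity beyond pointwise differentiability is not assumed
  separately: it comes from \<open>m > 5/2\<close>.
\<close>

definition classical_euler_solution ::
  "real \<Rightarrow> real \<Rightarrow> nat \<Rightarrow> (real^3 \<Rightarrow> real^3) \<Rightarrow> (real \<Rightarrow> real^3 \<Rightarrow> real^3)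
     \<Rightarrow> (real \<Rightarrow> real^3 \<Rightarrow> real) \<Rightarrow> bool" where
  "classical_euler_solution L T m v0 v p \<longleftrightarrow>
     sobolev_continuous L m T v \<and>
     (\<forall>t\<in>{0..<T}. periodic L (p t)) \<and>
     (\<forall>t\<in>{0..<T}. \<forall>x.
        (\<lambda>s. v s x) differentiable at t within {0..<T} \<and>
        v t differentiable at x \<and>
        p t differentiable at x \<and>
        time_derivative T v t x + advection (v t) x = - grad (p t) x \<and>
        divergence (v t) x = 0) \<and>
     continuous_on ({0..<T} \<times> UNIV) (\<lambda>(t, x). time_derivative T v t x) \<and>
     (\<forall>x. v 0 x = v0 x)"

definition deformation :: "(real^3 \<Rightarrow> real^3) \<Rightarrow> real^3 \<Rightarrow> real^3^3" where
  "deformation u x = (\<chi> i j. (pd i (\<lambda>y. u y $ j) x + pd j (\<lambda>y. u y $ i) x) / 2)"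

text \<open>The three eigenvalues, listed with multiplicity as the roots of the characteristic polynomial.\<close>

definition eigenvalues3 :: "real^3^3 \<Rightarrow> real \<Rightarrow> real \<Rightarrow> real \<Rightarrow> bool" where
  "eigenvalues3 A a b c \<longleftrightarrow> (\<forall>z. det (mat z - A) = (z - a) * (z - b) * (z - c))"

end

theory Submission
  imports Defs
begin

text \<open>
  At a point where the velocity has gradient \<open>G\<close> with \<open>tr G = 0\<close>, the symmetric part \<open>S\<close> of \<open>G\<close> satisfies
  \<open>\<lambda>\<^sub>1\<^sup>2 + \<lambda>\<^sub>2\<^sup>2 + \<lambda>\<^sub>3\<^sup>2 = (|G|\<^sup>2 + tr G\<^sup>2) / 2\<close> and
  \<open>4 \<lambda>\<^sub>1 \<lambda>\<^sub>2 \<lambda>\<^sub>3 = 4 det S = tr G\<^sup>3 / 3 + \<Sum>\<^sub>i\<^sub>j\<^sub>k G\<^sub>k\<^sub>i G\<^sub>i\<^sub>j G\<^sub>k\<^sub>j\<close>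
  (\<open>eigenvalues3_symmetric_part\<close>). For a divergence-free periodic field, integration by parts shows that
  \<open>tr G\<^sup>2\<close> and \<open>tr G\<^sup>3\<close> integrate to zero. The theorem therefore says that the gradient energy
  \<open>(1/2) \<integral> |\<nabla>v|\<^sup>2\<close> has the time derivative \<open>- \<integral> \<Sum>\<^sub>i\<^sub>j\<^sub>k \<partial>\<^sub>k v\<^sub>i \<partial>\<^sub>i v\<^sub>j \<partial>\<^sub>k v\<^sub>j\<close>. Formally one multiplies
  the equation by \<open>- \<Delta>v\<close>: the pressure gradient is orthogonal to the divergence-free field \<open>\<Delta>v\<close>, and
  integrating \<open>(v \<cdot> \<nabla>)v \<cdot> \<Delta>v\<close> by parts leaves only the cubic term.

  The velocity lies in \<open>H\<^sup>3\<close>, so this computation is done with the partial sums \<open>v\<^sup>N\<close> of the Fourier series over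
  cubes of frequencies. An \<open>H\<^sup>3\<close> bound makes the coefficients of \<open>v\<close> and \<open>\<nabla>v\<close> absolutely summable, because
  \<open>\<Sum> |k|\<^sup>2 / (1 + |k|\<^sup>6)\<close> converges over the three-dimensional lattice. Thus \<open>v\<^sup>N\<close> and its gradient converge
  uniformly, and by the uniqueness of Fourier coefficients (Stone--Weierstrass) the limit is \<open>v\<close>
  (\<open>fourier_series_C1\<close>); in particular \<open>v\<close> is continuously differentiable in space. The rate of
  convergence depends only on the \<open>H\<^sup>3\<close> norm, as does the \<open>L\<^sup>2\<close> bound on \<open>\<Delta>v\<^sup>N\<close>.

  By Parseval's identity the gradient energy of \<open>v\<^sup>N\<close> is a finite sum of squares of Fourier coefficients,
  each of which is differentiable in time by differentiation under the integral. Its derivative is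
  \<open>- \<integral> \<partial>\<^sub>t v \<cdot> \<Delta>v\<^sup>N\<close>. Here \<open>\<Delta>v\<^sup>N\<close> is smooth and divergence-free, hence orthogonal to the
  pressure gradient, which is continuous by the equation (\<open>truncated_rate_eq\<close>). As \<open>N\<close> grows, this derivative
  converges to the cubic integral, uniformly for times at which the \<open>H\<^sup>3\<close> norm is bounded
  (\<open>advection_conv\<close>), and the norm is locally bounded because the solution is continuous in time with
  values in the Sobolev space. Uniform convergence of the derivatives then gives the derivative of the limit
  (\<open>gradient_energy_has_derivative\<close>).
\<close>

section \<open>Integration over the period cell\<close>

locale periodic_box =
  fixes L :: real
  assumes L_pos: "0 < L"
begin

abbreviation I :: "(real^3 \<Rightarrow> real) \<Rightarrow> real" where
  "I f \<equiv> integral\<^sup>L (lebesgue_on (cell L)) f"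

abbreviation cell_integrable :: "(real^3 \<Rightarrow> real) \<Rightarrow> bool" where
  "cell_integrable f \<equiv> integrable (lebesgue_on (cell L)) f"

lemma cell_lebesgue [simp]: "cell L \<in> sets lebesgue"
  by (simp add: cell_def)

lemma I_eq_set_integral: "(LINT x:cell L|lebesgue. f x) = I f" for f :: "real^3 \<Rightarrow> real"
  by (simp add: set_lebesgue_integral_def integral_restrict_space)

lemma cell_integrable_iff_set_integrable: "set_integrable lebesgue (cell L) f \<longleftrightarrow> cell_integrable f" for f :: "real^3 \<Rightarrow> real"
  by (simp add: set_integrable_def integrable_restrict_space)

lemma finite_measure_cell: "finite_measure (lebesgue_on (cell L))"
  by (rule finite_measure_lebesgue_on) (simp add: cell_def)

lemma measure_cell: "measure (lebesgue_on (cell L)) (space (lebesgue_on (cell L))) = L ^ 3"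
proof -
  have "(0::real^3) \<in> cbox 0 (\<chi> i. L)" using L_pos by (auto simp: mem_box_cart)
  then have "cbox (0::real^3) (\<chi> i. L) \<noteq> {}" by blast
  then have "measure lborel (cbox (0::real^3) (\<chi> i. L)) = L ^ 3"
    by (subst content_cbox_cart) auto
  then show ?thesis
    by (simp add: measure_restrict_space cell_def)
qed

lemma I_const: "I (\<lambda>x. c) = c * L ^ 3"
  using measure_cell by simp

lemma cell_integrable_continuous:
  fixes f :: "real^3 \<Rightarrow> real"
  assumes "continuous_on UNIV f" shows "cell_integrable f"
proof -
  have "f absolutely_integrable_on cbox 0 (\<chi> i. L)"
    by (rule absolutely_integrable_continuous) (rule continuous_on_subset[OF assms], simp)
  then show ?thesis unfolding cell_integrable_iff_set_integrable[symmetric] by (simp add: cell_def)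
qed

lemma I_eq_HK: "cell_integrable f \<Longrightarrow> I f = integral (cell L) f"
  by (simp add: lebesgue_integral_eq_integral)

lemma I_mono: "cell_integrable f \<Longrightarrow> cell_integrable g \<Longrightarrow> (\<And>x. f x \<le> g x) \<Longrightarrow> I f \<le> I g"
  by (rule integral_mono)

lemma I_abs_le:
  assumes "cell_integrable f" "\<And>x. \<bar>f x\<bar> \<le> c" shows "\<bar>I f\<bar> \<le> c * L ^ 3"
proof -
  have "cell_integrable (\<lambda>x. c)" using finite_measure.integrable_const[OF finite_measure_cell] .
  have "\<bar>I f\<bar> \<le> I (\<lambda>x. \<bar>f x\<bar>)" using integral_abs_bound .
  also have "\<dots> \<le> I (\<lambda>x. c)"
    by (rule integral_mono) (use assms \<open>cell_integrable (\<lambda>x. c)\<close> in auto)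
  finally show ?thesis unfolding I_const .
qed

lemma I_tendsto_uniform:
  assumes f: "\<And>n. continuous_on UNIV (f n)" and g: "continuous_on UNIV g"
    and b: "\<And>n x. \<bar>f n x - g x\<bar> \<le> e n" and e: "e \<longlonglongrightarrow> 0"
  shows "(\<lambda>n. I (f n)) \<longlonglongrightarrow> I g"
proof (rule Lim_null_comparison[THEN Lim_null[THEN iffD2]])
  show "\<forall>\<^sub>F n in sequentially. norm (I (f n) - I g) \<le> e n * L ^ 3"
  proof (intro always_eventually allI)
    fix n
    have "I (f n) - I g = I (\<lambda>x. f n x - g x)"
      by (rule Bochner_Integration.integral_diff[symmetric]) (auto intro: cell_integrable_continuous f g)
    then show "norm (I (f n) - I g) \<le> e n * L ^ 3"
      using I_abs_le[of "\<lambda>x. f n x - g x" "e n"] b f g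
      by (auto intro!: cell_integrable_continuous continuous_intros)
  qed
  show "(\<lambda>n. e n * L ^ 3) \<longlonglongrightarrow> 0" using tendsto_mult_right[OF e, of "L^3"] by simp
qed

text \<open>
  Splitting the shifted cell at the hyperplane through the old face and moving the protruding part
  back by one period recovers the original cell.
\<close>

lemma integral_periodic_shift_small:
  fixes f :: "real^3 \<Rightarrow> real"
  assumes f: "continuous_on UNIV f" and p: "periodic L f" and s: "0 \<le> s" "s \<le> L"
  shows "integral (cell L) (\<lambda>x. f (x + axis i s)) = integral (cell L) f"
proof -
  let ?u = "(\<chi> j. L) :: real^3"
  let ?e = "axis i 1 :: real^3"
  have e: "?e \<in> Basis" by (auto simp: Basis_vec_def)
  have ie: "x \<bullet> ?e = x $ i" for x :: "real^3" by (simp add: inner_axis)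
  have int: "f integrable_on cbox a b" for a b :: "real^3"
    by (rule integrable_continuous) (rule continuous_on_subset[OF f], simp)
  have box1: "cbox (axis i s) (?u + axis i s) \<inter> {x. x \<bullet> ?e \<le> L} = cbox (axis i s) (?u::real^3)"
    unfolding ie interval_split_cart[unfolded interval_cbox_cart] using s by (intro arg_cong2[where f=cbox]) (auto simp: vec_eq_iff axis_def)
  have box2: "cbox (axis i s) (?u + axis i s) \<inter> {x. x \<bullet> ?e \<ge> L} = cbox (axis i L) (?u + axis i s::real^3)"
    unfolding ie interval_split_cart[unfolded interval_cbox_cart] using s by (intro arg_cong2[where f=cbox]) (auto simp: vec_eq_iff axis_def)
  have box3: "cbox 0 ?u \<inter> {x. x \<bullet> ?e \<le> s} = cbox 0 (\<chi> j. if j = i then s else L)"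
    unfolding ie interval_split_cart[unfolded interval_cbox_cart] using s by (intro arg_cong2[where f=cbox]) (auto simp: vec_eq_iff axis_def)
  have box4: "cbox 0 ?u \<inter> {x. x \<bullet> ?e \<ge> s} = cbox (axis i s) (?u::real^3)"
    unfolding ie interval_split_cart[unfolded interval_cbox_cart] using s by (intro arg_cong2[where f=cbox]) (auto simp: vec_eq_iff axis_def)
  have sh: "integral (cbox (axis i L) (?u + axis i s)) f = integral (cbox 0 (\<chi> j. if j = i then s else L)) f"
  proof -
    have "integral (cbox (axis i L - axis i L) (?u + axis i s - axis i L)) (\<lambda>x. f (x + axis i L))
        = integral (cbox (axis i L) (?u + axis i s)) f"
      by (rule integral_shift_cbox)
    moreover have "?u + axis i s - axis i L = (\<chi> j. if j = i then s else L)"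
      by (simp add: vec_eq_iff axis_def)
    ultimately show ?thesis using p by (simp add: periodic_def)
  qed
  have "integral (cell L) (\<lambda>x. f (x + axis i s)) = integral (cbox (axis i s) (?u + axis i s)) f"
    using integral_shift_cbox[of "axis i s" "axis i s" "?u + axis i s" f] by (simp add: cell_def)
  also have "\<dots> = integral (cbox (axis i s) ?u) f + integral (cbox (axis i L) (?u + axis i s)) f"
    using integral_split[OF int e, of "axis i s" "?u + axis i s" L] by (simp add: box1 box2)
  also have "\<dots> = integral (cbox (axis i s) ?u) f + integral (cbox 0 (\<chi> j. if j = i then s else L)) f"
    by (simp add: sh)
  also have "\<dots> = integral (cbox 0 ?u) f"
    using integral_split[OF int e, of 0 ?u s] by (simp add: box3 box4)
  finally show ?thesis by (simp add: cell_def)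
qed

lemma has_real_derivative_along_axis:
  assumes "f differentiable at (x + axis i s)"
  shows "((\<lambda>s. f (x + axis i s)) has_real_derivative pd i f (x + axis i s)) (at s within S)"
proof -
  define y where "y = x + axis i s"
  have ax: "axis i s = s *\<^sub>R (axis i 1 :: real^3)" for s :: real
    by (simp add: vec_eq_iff axis_def)
  have d: "(f has_derivative frechet_derivative f (at y)) (at (x + s *\<^sub>R axis i 1))"
    using assms by (simp add: frechet_derivative_works y_def ax[of s, symmetric])
  then have lin: "linear (frechet_derivative f (at y))"
    by (rule has_derivative_linear)
  have "((\<lambda>s. x + s *\<^sub>R axis i 1) has_derivative (\<lambda>s. s *\<^sub>R axis i 1)) (at s within S)"
    by (auto intro!: derivative_eq_intros)
  then have "((\<lambda>s. f (x + s *\<^sub>R axis i 1)) has_derivative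
      (\<lambda>h. frechet_derivative f (at y) (h *\<^sub>R axis i 1))) (at s within S)"
    by (rule has_derivative_compose) (rule d)
  moreover have "(\<lambda>h. frechet_derivative f (at y) (h *\<^sub>R axis i 1)) = (*) (pd i f y)"
    by (simp add: fun_eq_iff pd_def linear_scale[OF lin])
  ultimately have "((\<lambda>s. f (x + s *\<^sub>R axis i 1)) has_real_derivative pd i f y) (at s within S)"
    unfolding has_field_derivative_def by metis
  then show ?thesis unfolding ax[symmetric] y_def .
qed

lemma differentiable_continuous_UNIV:
  "(\<And>x. f differentiable at x) \<Longrightarrow> continuous_on UNIV f"
  for f :: "real^3 \<Rightarrow> 'b::real_normed_vector"
  by (simp add: continuous_at_imp_continuous_on differentiable_imp_continuous_within)

text \<open>
  The integral of the translates of a periodic function is constant, and its derivative with respect to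
  the translation is the integral of the partial derivative. This replaces Fubini's theorem and the
  fundamental theorem of calculus.
\<close>

lemma I_pd_eq_0:
  assumes d: "\<And>x. f differentiable at x" and c: "continuous_on UNIV (pd i f)" and p: "periodic L f"
  shows "I (pd i f) = 0"
proof -
  have fc: "continuous_on UNIV f" using d by (rule differentiable_continuous_UNIV)
  have ax: "continuous_on UNIV (\<lambda>z. snd z + axis i (fst z) :: real^3)"
  proof -
    have "(\<lambda>z. snd z + axis i (fst z)) = (\<lambda>z. snd z + fst z *\<^sub>R (axis i 1 :: real^3))"
      by (simp add: fun_eq_iff vec_eq_iff axis_def)
    moreover have "continuous_on UNIV (\<lambda>z. snd z + fst z *\<^sub>R (axis i 1 :: real^3))"
      by (intro continuous_intros)
    ultimately show ?thesis by (simp only:)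
  qed
  have sh: "continuous_on UNIV (\<lambda>x. f (x + axis i s))" for s
    by (intro continuous_intros continuous_on_compose2[OF fc]) auto
  have "((\<lambda>s. integral (cbox 0 (\<chi> i. L)) (\<lambda>x. f (x + axis i s))) has_field_derivative
      integral (cbox 0 (\<chi> i. L)) (\<lambda>x. pd i f (x + axis i 0))) (at 0 within {0..L})"
  proof (rule leibniz_rule_field_derivative)
    show "((\<lambda>s. f (x + axis i s)) has_real_derivative pd i f (x + axis i s)) (at s within {0..L})" for s x
      by (rule has_real_derivative_along_axis) (rule d)
    show "(\<lambda>x. f (x + axis i s)) integrable_on cbox 0 (\<chi> i. L)" for s
      by (rule integrable_continuous) (rule continuous_on_subset[OF sh], simp)
    show "continuous_on ({0..L} \<times> cbox 0 (\<chi> i. L)) (\<lambda>(s, x). pd i f (x + axis i s))"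
      unfolding case_prod_beta
      by (rule continuous_on_subset[OF continuous_on_compose2[OF c ax]]) auto
  qed (use L_pos in auto)
  moreover have "((\<lambda>s. integral (cbox 0 (\<chi> i. L)) (\<lambda>x. f (x + axis i s))) has_field_derivative 0) (at 0 within {0..L})"
  proof (rule has_field_derivative_transform_within[where d=1])
    show "((\<lambda>s. integral (cell L) f) has_field_derivative 0) (at 0 within {0..L})" by simp
    show "integral (cell L) f = integral (cbox 0 (\<chi> i. L)) (\<lambda>x. f (x + axis i s))" if "s \<in> {0..L}" for s
      using integral_periodic_shift_small[OF fc p, of s i] that by (simp add: cell_def)
  qed (use L_pos in auto)
  moreover have "at 0 within {0..L} \<noteq> bot"
    using L_pos by (simp add: at_within_Icc_at_right)
  ultimately have "integral (cbox 0 (\<chi> i. L)) (\<lambda>x. pd i f (x + axis i 0)) = 0"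
    using has_field_derivative_unique by blast
  moreover have "axis i 0 = (0::real^3)" by (simp add: vec_eq_iff axis_def)
  ultimately show ?thesis
    using I_eq_HK[OF cell_integrable_continuous[OF c]] by (simp add: cell_def)
qed

end

section \<open>Trigonometric polynomials and Fourier coefficients\<close>

context periodic_box
begin

text \<open>
  The wave vectors for which the plane waves have period \<open>L\<close> in each coordinate.
\<close>

definition wave :: "int^3 \<Rightarrow> real^3" where
  "wave k = (\<chi> i. 2 * pi / L * of_int (k $ i))"

definition trig :: "(int^3) set \<Rightarrow> (int^3 \<Rightarrow> real) \<Rightarrow> (int^3 \<Rightarrow> real) \<Rightarrow> real^3 \<Rightarrow> real" where
  "trig K a b x = (\<Sum>k\<in>K. a k * cos (wave k \<bullet> x) + b k * sin (wave k \<bullet> x))"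

lemma wave_uminus [simp]: "wave (- k) = - wave k"
  by (simp add: wave_def vec_eq_iff)

lemma wave_add: "wave (k + l) = wave k + wave l"
  by (simp add: wave_def vec_eq_iff algebra_simps)

lemma wave_diff: "wave (k - l) = wave k - wave l"
  by (simp add: wave_def vec_eq_iff algebra_simps)

lemma wave_0 [simp]: "wave 0 = 0"
  by (simp add: wave_def vec_eq_iff)

lemma wave_nth: "wave k $ i = 2 * pi / L * of_int (k $ i)"
  by (simp add: wave_def)

lemma wave_period: "wave k \<bullet> (x + axis i L) = wave k \<bullet> x + 2 * pi * of_int (k $ i)"
  using L_pos by (simp add: inner_add_right inner_axis wave_nth)

lemma cos_wave_periodic: "cos (wave k \<bullet> (x + axis i L)) = cos (wave k \<bullet> x)"
  unfolding wave_period cos_add by simp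

lemma sin_wave_periodic: "sin (wave k \<bullet> (x + axis i L)) = sin (wave k \<bullet> x)"
  unfolding wave_period sin_add by simp

lemma periodic_trig: "periodic L (trig K a b)"
  by (simp add: periodic_def trig_def cos_wave_periodic sin_wave_periodic)

lemma trig_has_derivative:
  "(trig K a b has_derivative
     (\<lambda>h. \<Sum>k\<in>K. (wave k \<bullet> h) * (b k * cos (wave k \<bullet> x) - a k * sin (wave k \<bullet> x)))) (at x within S)"
  unfolding trig_def[abs_def]
  by (auto intro!: derivative_eq_intros sum.cong simp: fun_eq_iff algebra_simps)

lemma pd_eqI: "(f has_derivative D) (at x) \<Longrightarrow> pd i f x = D (axis i 1)"
  by (simp add: pd_def frechet_derivative_at[symmetric])

lemma pd_trig: "pd i (trig K a b) = trig K (\<lambda>k. wave k $ i * b k) (\<lambda>k. - (wave k $ i * a k))"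
proof
  fix x
  show "pd i (trig K a b) x = trig K (\<lambda>k. wave k $ i * b k) (\<lambda>k. - (wave k $ i * a k)) x"
    unfolding pd_eqI[OF trig_has_derivative] unfolding trig_def
    by (intro sum.cong) (auto simp: inner_axis algebra_simps)
qed

lemma differentiable_trig: "trig K a b differentiable at x"
  using trig_has_derivative unfolding differentiable_def by blast

lemma continuous_trig: "continuous_on UNIV (trig K a b)"
  using differentiable_trig by (rule differentiable_continuous_UNIV)

lemma cell_integrable_trig: "cell_integrable (trig K a b)"
  by (rule cell_integrable_continuous) (rule continuous_trig)

text \<open>
  Trigonometric polynomials are closed under differentiation, which makes them smooth test functions.
\<close>

lemma iter_pd_trig: "\<exists>c d. iter_pd js (trig K a b) = trig K c d"
proof (induction js)
  case Nil
  then show ?case by auto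
next
  case (Cons i js)
  then obtain c d where "iter_pd js (trig K a b) = trig K c d" by blast
  then show ?case by (auto simp: pd_trig)
qed

lemma test_function_trig: "test_function L (trig K a b)"
  unfolding test_function_def using periodic_trig iter_pd_trig differentiable_trig by metis

lemma I_pd_trig: "I (pd i (trig K a b)) = 0"
  by (rule I_pd_eq_0) (auto simp: differentiable_trig pd_trig periodic_trig continuous_trig)

lemma I_cos: "I (\<lambda>x. cos (wave k \<bullet> x)) = (if k = 0 then L ^ 3 else 0)"
proof (cases "k = 0")
  case True
  then show ?thesis using I_const[of 1] by simp
next
  case False
  then obtain i where i: "wave k $ i \<noteq> 0" using L_pos by (auto simp: vec_eq_iff wave_nth)
  have "pd i (trig {k} (\<lambda>_. 0) (\<lambda>_. 1 / wave k $ i)) = (\<lambda>x. cos (wave k \<bullet> x))"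
    unfolding pd_trig using i by (simp add: trig_def fun_eq_iff)
  then show ?thesis using I_pd_trig[of i "{k}" "\<lambda>_. 0" "\<lambda>_. 1 / wave k $ i"] False by simp
qed

lemma I_sin: "I (\<lambda>x. sin (wave k \<bullet> x)) = 0"
proof (cases "k = 0")
  case False
  then obtain i where i: "wave k $ i \<noteq> 0" using L_pos by (auto simp: vec_eq_iff wave_nth)
  have "pd i (trig {k} (\<lambda>_. - 1 / wave k $ i) (\<lambda>_. 0)) = (\<lambda>x. sin (wave k \<bullet> x))"
    unfolding pd_trig using i by (simp add: trig_def fun_eq_iff)
  then show ?thesis using I_pd_trig[of i "{k}" "\<lambda>_. - 1 / wave k $ i" "\<lambda>_. 0"] by simp
qed simp

lemma cont_cos: "continuous_on UNIV (\<lambda>x. cos (wave k \<bullet> x))"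
  and cont_sin: "continuous_on UNIV (\<lambda>x. sin (wave k \<bullet> x))"
  by (intro continuous_intros)+

lemma I_cos_cos: "I (\<lambda>x. cos (wave k \<bullet> x) * cos (wave l \<bullet> x)) = L ^ 3 / 2 * (of_bool (k = l) + of_bool (k = - l))"
proof -
  have "(\<lambda>x. cos (wave k \<bullet> x) * cos (wave l \<bullet> x)) = (\<lambda>x. (cos (wave (k - l) \<bullet> x) + cos (wave (k + l) \<bullet> x)) / 2)"
    by (simp add: cos_times_cos wave_diff wave_add inner_diff_left inner_add_left)
  then show ?thesis
    by (simp add: cell_integrable_continuous cont_cos I_cos eq_neg_iff_add_eq_0 add_divide_distrib)
qed

lemma I_sin_sin: "I (\<lambda>x. sin (wave k \<bullet> x) * sin (wave l \<bullet> x)) = L ^ 3 / 2 * (of_bool (k = l) - of_bool (k = - l))"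
proof -
  have "(\<lambda>x. sin (wave k \<bullet> x) * sin (wave l \<bullet> x)) = (\<lambda>x. (cos (wave (k - l) \<bullet> x) - cos (wave (k + l) \<bullet> x)) / 2)"
    by (simp add: sin_times_sin wave_diff wave_add inner_diff_left inner_add_left)
  then show ?thesis
    by (simp add: cell_integrable_continuous cont_cos I_cos eq_neg_iff_add_eq_0 diff_divide_distrib)
qed

lemma I_sin_cos: "I (\<lambda>x. sin (wave k \<bullet> x) * cos (wave l \<bullet> x)) = 0"
proof -
  have "(\<lambda>x. sin (wave k \<bullet> x) * cos (wave l \<bullet> x)) = (\<lambda>x. (sin (wave (k + l) \<bullet> x) + sin (wave (k - l) \<bullet> x)) / 2)"
    by (simp add: sin_times_cos wave_diff wave_add inner_diff_left inner_add_left)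
  then show ?thesis
    by (simp add: cell_integrable_continuous cont_sin I_sin)
qed

lemma I_cos_sin: "I (\<lambda>x. cos (wave k \<bullet> x) * sin (wave l \<bullet> x)) = 0"
  using I_sin_cos[of l k] by (simp only: mult.commute)

lemma cell_integrable_mult_continuous:
  assumes u: "cell_integrable u" and g: "continuous_on UNIV g"
  shows "cell_integrable (\<lambda>x. u x * g x)"
proof -
  have "compact (g ` cell L)"
    by (rule compact_continuous_image) (auto intro: continuous_on_subset[OF g] simp: cell_def)
  then obtain B where b: "\<And>x. x \<in> cell L \<Longrightarrow> \<bar>g x\<bar> \<le> B"
    using compact_imp_bounded bounded_iff by (metis image_eqI real_norm_def)
  show ?thesis
  proof (rule Bochner_Integration.integrable_bound)
    show "cell_integrable (\<lambda>x. B * u x)" using u by simp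
    have "g \<in> borel_measurable (lebesgue_on (cell L))"
      by (rule continuous_imp_measurable_on_sets_lebesgue) (auto intro: continuous_on_subset[OF g])
    then show "(\<lambda>x. u x * g x) \<in> borel_measurable (lebesgue_on (cell L))"
      using u by (intro borel_measurable_times) auto
    show "AE x in lebesgue_on (cell L). norm (u x * g x) \<le> norm (B * u x)"
    proof (intro AE_I2)
      fix x assume "x \<in> space (lebesgue_on (cell L))"
      then have "\<bar>g x\<bar> \<le> B" using b by simp
      then have "\<bar>u x\<bar> * \<bar>g x\<bar> \<le> \<bar>u x\<bar> * \<bar>B\<bar>"
        by (intro mult_left_mono) auto
      then show "norm (u x * g x) \<le> norm (B * u x)" by (simp add: abs_mult mult.commute)
    qed
  qed
qed

definition ccoef :: "(real^3 \<Rightarrow> real) \<Rightarrow> int^3 \<Rightarrow> real" where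
  "ccoef u k = I (\<lambda>x. u x * cos (wave k \<bullet> x))"

definition scoef :: "(real^3 \<Rightarrow> real) \<Rightarrow> int^3 \<Rightarrow> real" where
  "scoef u k = I (\<lambda>x. u x * sin (wave k \<bullet> x))"

lemma ccoef_uminus: "ccoef u (- k) = ccoef u k"
  and scoef_uminus: "scoef u (- k) = - scoef u k"
  by (simp_all add: ccoef_def scoef_def)

lemma cell_integrable_cos: "cell_integrable u \<Longrightarrow> cell_integrable (\<lambda>x. u x * cos (wave k \<bullet> x))"
  and cell_integrable_sin: "cell_integrable u \<Longrightarrow> cell_integrable (\<lambda>x. u x * sin (wave k \<bullet> x))"
  by (simp_all add: cell_integrable_mult_continuous cont_cos cont_sin)

lemma cell_integrable_mult_trig: "cell_integrable u \<Longrightarrow> cell_integrable (\<lambda>x. u x * trig K a b x)"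
  unfolding trig_def sum_distrib_left ring_distribs
  by (intro Bochner_Integration.integrable_sum Bochner_Integration.integrable_add)
     (simp_all add: mult.left_commute[of "u _"] cell_integrable_cos cell_integrable_sin)

lemma I_mult_trig:
  assumes "cell_integrable u"
  shows "I (\<lambda>x. u x * trig K a b x) = (\<Sum>k\<in>K. a k * ccoef u k + b k * scoef u k)"
  unfolding trig_def sum_distrib_left ring_distribs
  using assms
  by (simp add: mult.left_commute[of "u _"] cell_integrable_cos cell_integrable_sin ccoef_def scoef_def)

lemma ccoef_trig:
  assumes "finite K" "\<And>k. k \<in> K \<Longrightarrow> - k \<in> K" "\<And>k. a (- k) = a k" "l \<in> K"
  shows "ccoef (trig K a b) l = L ^ 3 * a l"
proof -
  have "ccoef (trig K a b) l = I (\<lambda>x. cos (wave l \<bullet> x) * trig K a b x)"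
    by (simp add: ccoef_def mult.commute)
  also have "\<dots> = (\<Sum>k\<in>K. a k * ccoef (\<lambda>x. cos (wave l \<bullet> x)) k + b k * scoef (\<lambda>x. cos (wave l \<bullet> x)) k)"
    by (rule I_mult_trig) (simp add: cell_integrable_continuous cont_cos)
  also have "\<dots> = (\<Sum>k\<in>K. (if k = l then L ^ 3 / 2 * a k else 0) + (if k = - l then L ^ 3 / 2 * a k else 0))"
    by (intro sum.cong refl) (auto simp: ccoef_def scoef_def I_cos_cos I_cos_sin assms(3))
  also have "\<dots> = L ^ 3 * a l"
    using assms by (simp add: sum.distrib)
  finally show ?thesis .
qed

lemma scoef_trig:
  assumes "finite K" "\<And>k. k \<in> K \<Longrightarrow> - k \<in> K" "\<And>k. b (- k) = - b k" "l \<in> K"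
  shows "scoef (trig K a b) l = L ^ 3 * b l"
proof -
  have "scoef (trig K a b) l = I (\<lambda>x. sin (wave l \<bullet> x) * trig K a b x)"
    by (simp add: scoef_def mult.commute)
  also have "\<dots> = (\<Sum>k\<in>K. a k * ccoef (\<lambda>x. sin (wave l \<bullet> x)) k + b k * scoef (\<lambda>x. sin (wave l \<bullet> x)) k)"
    by (rule I_mult_trig) (simp add: cell_integrable_continuous cont_sin)
  also have "\<dots> = (\<Sum>k\<in>K. (if k = l then L ^ 3 / 2 * b k else 0) - (if k = - l then L ^ 3 / 2 * b k else 0))"
    by (intro sum.cong refl) (auto simp: ccoef_def scoef_def I_sin_sin I_sin_cos, metis eq_neg_iff_add_eq_0 mult_2)
  also have "\<dots> = L ^ 3 * b l"
    using assms by (simp add: sum_subtractf)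
  finally show ?thesis .
qed

text \<open>
  Parseval's identity. A frequency and its opposite carry the same two waves, so orthogonality determines
  coefficients only after these have been made even for the cosines and odd for the sines; the
  coefficients of a function have this symmetry.
\<close>

lemma I_trig_trig:
  assumes "finite K" "\<And>k. k \<in> K \<Longrightarrow> - k \<in> K" "\<And>k. a (- k) = a k" "\<And>k. b (- k) = - b k"
  shows "I (\<lambda>x. trig K a b x * trig K c d x) = L ^ 3 * (\<Sum>k\<in>K. a k * c k + b k * d k)"
  unfolding I_mult_trig[OF cell_integrable_trig] sum_distrib_left
  by (intro sum.cong refl) (simp add: ccoef_trig scoef_trig assms algebra_simps)

definition cube :: "nat \<Rightarrow> (int^3) set" where
  "cube N = {k. \<forall>i. \<bar>k $ i\<bar> \<le> int N}"

lemma cube_uminus: "k \<in> cube N \<Longrightarrow> - k \<in> cube N"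
  by (simp add: cube_def)

lemma cube_mono: "N \<le> M \<Longrightarrow> cube N \<subseteq> cube M"
  by (auto simp: cube_def intro: order_trans)

lemma cube_eq: "cube N = vec_lambda ` (PiE UNIV (\<lambda>_. {- int N..int N}))"
proof (intro set_eqI iffI)
  fix k assume "k \<in> cube N"
  then have "k = vec_lambda (vec_nth k)" "vec_nth k \<in> PiE UNIV (\<lambda>_. {- int N..int N})"
    by (auto simp: cube_def abs_le_iff) (metis minus_le_iff)
  then show "k \<in> vec_lambda ` (PiE UNIV (\<lambda>_. {- int N..int N}))" by blast
qed (auto simp: cube_def abs_le_iff PiE_def Pi_def minus_le_iff)

lemma finite_cube: "finite (cube N)"
  unfolding cube_eq by (intro finite_imageI finite_PiE) auto

text \<open>
  The sum runs over both \<open>k\<close> and \<open>- k\<close>, so the usual factor \<open>2 / L\<^sup>3\<close> of the real Fourier series becomes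
  \<open>1 / L\<^sup>3\<close>.
\<close>

definition psum :: "nat \<Rightarrow> (real^3 \<Rightarrow> real) \<Rightarrow> real^3 \<Rightarrow> real" where
  "psum N u = trig (cube N) (\<lambda>k. ccoef u k / L ^ 3) (\<lambda>k. scoef u k / L ^ 3)"

lemma L2_per_integrable:
  assumes "L2_per L u" shows "cell_integrable u" "cell_integrable (\<lambda>x. (u x)\<^sup>2)"
proof -
  show sq: "cell_integrable (\<lambda>x. (u x)\<^sup>2)"
    using assms unfolding L2_per_def cell_integrable_iff_set_integrable by blast
  show "cell_integrable u"
  proof (rule Bochner_Integration.integrable_bound)
    show "cell_integrable (\<lambda>x. 1 + (u x)\<^sup>2)"
      using sq finite_measure.integrable_const[OF finite_measure_cell] by (intro Bochner_Integration.integrable_add)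
    show "u \<in> borel_measurable (lebesgue_on (cell L))"
      using assms by (auto simp: L2_per_def intro: measurable_restrict_space1)
    have "\<bar>y\<bar> \<le> \<bar>1 + y\<^sup>2\<bar>" for y :: real
    proof -
      have "0 \<le> (\<bar>y\<bar> - 1)\<^sup>2 + y\<^sup>2" by simp
      then show ?thesis unfolding power2_diff by simp
    qed
    then show "AE x in lebesgue_on (cell L). norm (u x) \<le> norm (1 + (u x)\<^sup>2)" by simp
  qed
qed

text \<open>
  The mean square distance between the function and its partial sum is nonnegative.
\<close>

lemma Bessel:
  assumes "L2_per L u"
  shows "(\<Sum>k\<in>cube N. (ccoef u k)\<^sup>2 + (scoef u k)\<^sup>2) \<le> L ^ 3 * I (\<lambda>x. (u x)\<^sup>2)"
proof -
  let ?S = "\<Sum>k\<in>cube N. (ccoef u k)\<^sup>2 + (scoef u k)\<^sup>2"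
  note int = L2_per_integrable[OF assms]
  have i1: "cell_integrable (\<lambda>x. u x * psum N u x)" unfolding psum_def by (rule cell_integrable_mult_trig) (rule int)
  have i2: "cell_integrable (\<lambda>x. psum N u x * psum N u x)" unfolding psum_def by (rule cell_integrable_mult_trig) (rule cell_integrable_trig)
  have e1: "I (\<lambda>x. u x * psum N u x) = ?S / L ^ 3"
    unfolding psum_def I_mult_trig[OF int(1)] by (simp add: sum_divide_distrib power2_eq_square add_divide_distrib)
  have "I (\<lambda>x. psum N u x * psum N u x)
      = L ^ 3 * (\<Sum>k\<in>cube N. ccoef u k / L ^ 3 * (ccoef u k / L ^ 3) + scoef u k / L ^ 3 * (scoef u k / L ^ 3))"
    unfolding psum_def by (rule I_trig_trig) (auto simp: finite_cube cube_uminus ccoef_uminus scoef_uminus)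
  also have "\<dots> = ?S / L ^ 3"
    unfolding sum_distrib_left sum_divide_distrib
    by (intro sum.cong refl) (use L_pos in \<open>simp add: field_simps power2_eq_square\<close>)
  finally have e2: "I (\<lambda>x. psum N u x * psum N u x) = ?S / L ^ 3" .
  have "0 \<le> I (\<lambda>x. (u x - psum N u x)\<^sup>2)" by (rule integral_nonneg_AE) simp
  also have "(\<lambda>x. (u x - psum N u x)\<^sup>2) = (\<lambda>x. (u x)\<^sup>2 - 2 * (u x * psum N u x) + psum N u x * psum N u x)"
    by (simp add: fun_eq_iff power2_eq_square algebra_simps)
  also have "I \<dots> = I (\<lambda>x. (u x)\<^sup>2) - 2 * I (\<lambda>x. u x * psum N u x) + I (\<lambda>x. psum N u x * psum N u x)"
    using int i1 i2 by simp
  finally show ?thesis using e1 e2 L_pos by (simp add: field_simps)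
qed

lemma weak_derivative_trig:
  assumes w: "weak_derivative L js u w"
  shows "I (\<lambda>x. u x * iter_pd js (trig K a b) x) = (- 1) ^ length js * I (\<lambda>x. w x * trig K a b x)"
  using conjunct2[OF w[unfolded weak_derivative_def], rule_format, OF test_function_trig]
  unfolding I_eq_set_integral .

lemma coef_weak_0:
  assumes "weak_derivative L [] u w"
  shows "ccoef w k = ccoef u k" "scoef w k = scoef u k"
  using weak_derivative_trig[OF assms, of "{k}" "\<lambda>_. 1" "\<lambda>_. 0"] weak_derivative_trig[OF assms, of "{k}" "\<lambda>_. 0" "\<lambda>_. 1"]
  by (simp_all add: trig_def ccoef_def scoef_def)

text \<open>
  Testing the weak derivative with a plane wave multiplies its coefficients by the cube of the frequency
  and exchanges sine and cosine.
\<close>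

lemma coef_weak_3:
  assumes "weak_derivative L [i, i, i] u w"
  shows "(ccoef w k)\<^sup>2 + (scoef w k)\<^sup>2 = (wave k $ i) ^ 6 * ((ccoef u k)\<^sup>2 + (scoef u k)\<^sup>2)"
proof -
  have "- ccoef w k = (wave k $ i) ^ 3 * scoef u k"
    using weak_derivative_trig[OF assms, of "{k}" "\<lambda>_. 1" "\<lambda>_. 0"]
    by (simp add: pd_trig trig_def ccoef_def scoef_def power3_eq_cube mult.assoc mult.left_commute[of "u _"])
  moreover have "- scoef w k = - ((wave k $ i) ^ 3 * ccoef u k)"
    using weak_derivative_trig[OF assms, of "{k}" "\<lambda>_. 0" "\<lambda>_. 1"]
    by (simp add: pd_trig trig_def ccoef_def scoef_def power3_eq_cube mult.assoc mult.left_commute[of "u _"])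
  ultimately have "ccoef w k = - ((wave k $ i) ^ 3 * scoef u k)" "scoef w k = (wave k $ i) ^ 3 * ccoef u k"
    by simp_all
  then show ?thesis by (simp add: power_mult_distrib algebra_simps flip: power_mult)
qed

end

section \<open>Fourier coefficients determine a continuous periodic function\<close>

lemma periodic_shift_int:
  assumes "periodic L f" shows "f (x + (\<chi> i. L * of_int (n $ i))) = f x"
proof -
  have nat: "f (x + axis i (L * real m)) = f x" for x i m
  proof (induction m arbitrary: x)
    case 0
    have "x + axis i (L * real 0) = x" by (simp add: vec_eq_iff axis_def)
    then show ?case by (simp only:)
  next
    case (Suc m)
    have "x + axis i (L * real (Suc m)) = x + axis i (L * real m) + axis i L"
      by (simp add: vec_eq_iff axis_def algebra_simps)
    then show ?case using Suc assms by (simp only: periodic_def)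
  qed
  have int: "f (x + axis i (L * of_int m)) = f x" for x i and m :: int
  proof (cases "m \<ge> 0")
    case True
    then show ?thesis using nat[of x i "nat m"] by simp
  next
    case False
    have "x + axis i (L * of_int m) + axis i (L * real (nat (- m))) = x"
      using False by (simp add: vec_eq_iff axis_def)
    then show ?thesis using nat[of "x + axis i (L * of_int m)" i "nat (- m)"] by (simp only:)
  qed
  have "x + (\<chi> i. L * of_int (n $ i)) =
      x + axis 1 (L * of_int (n $ 1)) + axis 2 (L * of_int (n $ 2)) + axis 3 (L * of_int (n $ 3))"
    by (simp add: vec_eq_iff axis_def forall_3)
  then show ?thesis by (simp only: int)
qed

context periodic_box
begin

text \<open>
  The embedding of the torus as a product of three circles. Polynomials in these coordinates are the
  trigonometric polynomials, to which the Stone--Weierstrass theorem applies on the compact image.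
\<close>

definition circle_coords :: "real^3 \<Rightarrow> (real^3) \<times> (real^3)" where
  "circle_coords x = ((\<chi> i. cos (wave (axis i 1) \<bullet> x)), (\<chi> i. sin (wave (axis i 1) \<bullet> x)))"

lemma wave_axis_inner: "wave (axis i 1) \<bullet> x = 2 * pi / L * x $ i"
proof -
  have "wave (axis i 1) = axis i (2 * pi / L)" by (simp add: vec_eq_iff wave_nth axis_def)
  then show ?thesis by (simp add: inner_axis inner_commute)
qed

lemma circle_coords_eqD:
  assumes "circle_coords x = circle_coords y" and "periodic L f"
  shows "f x = f y"
proof -
  have "\<exists>n::int. x $ i = y $ i + L * of_int n" for i
  proof -
    have "sin (2 * pi / L * x $ i) = sin (2 * pi / L * y $ i) \<and> cos (2 * pi / L * x $ i) = cos (2 * pi / L * y $ i)"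
      using assms(1) by (simp add: circle_coords_def vec_eq_iff wave_axis_inner)
    then obtain n :: int where "2 * pi / L * x $ i = 2 * pi / L * y $ i + 2 * pi * of_int n"
      unfolding sin_cos_eq_iff by blast
    then have "2 * pi * x $ i = 2 * pi * (y $ i + L * of_int n)"
      using L_pos by (simp add: field_simps)
    then show ?thesis by auto
  qed
  then obtain n :: "3 \<Rightarrow> int" where "\<And>i. x $ i = y $ i + L * of_int (n i)" by metis
  then have "x = y + (\<chi> i. L * of_int ((\<chi> i. n i) $ i))" by (simp add: vec_eq_iff)
  then show ?thesis using periodic_shift_int[OF assms(2)] by metis
qed

lemma continuous_circle_coords: "continuous_on A circle_coords"
  unfolding circle_coords_def[abs_def] by (intro continuous_intros)

lemma periodic_representative: "\<exists>y\<in>cell L. \<forall>f. periodic L f \<longrightarrow> f x = (f y :: real)"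
proof (intro bexI allI impI)
  let ?n = "\<chi> i. - \<lfloor>x $ i / L\<rfloor>"
  let ?y = "x + (\<chi> i. L * of_int (?n $ i))"
  show "f x = f ?y" if "periodic L f" for f :: "real^3 \<Rightarrow> real"
    using periodic_shift_int[OF that, of x ?n] by simp
  have "0 \<le> z - L * of_int \<lfloor>z / L\<rfloor> \<and> z - L * of_int \<lfloor>z / L\<rfloor> \<le> L" for z
  proof -
    have "of_int \<lfloor>z / L\<rfloor> \<le> z / L" "z / L \<le> of_int \<lfloor>z / L\<rfloor> + 1" by linarith+
    then have "of_int \<lfloor>z / L\<rfloor> * L \<le> z" "z \<le> (of_int \<lfloor>z / L\<rfloor> + 1) * L"
      using L_pos by (simp_all only: pos_le_divide_eq pos_divide_le_eq)
    then show ?thesis by (simp add: algebra_simps)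
  qed
  then show "?y \<in> cell L" by (simp add: cell_def mem_box_cart)
qed

lemma cell_nonempty: "box 0 (\<chi> i. L) \<noteq> ({} :: (real^3) set)"
proof -
  have "(\<chi> i. L / 2) \<in> box 0 ((\<chi> i. L) :: real^3)" using L_pos by (simp add: mem_box_cart)
  then show ?thesis by blast
qed

lemma I_square_eq_0:
  assumes h: "continuous_on UNIV h" "periodic L h" and 0: "I (\<lambda>x. (h x)\<^sup>2) = 0"
  shows "h x = 0"
proof -
  have c: "continuous_on UNIV (\<lambda>x. (h x)\<^sup>2)" using h by (intro continuous_intros)
  have "integral (cbox 0 (\<chi> i. L)) (\<lambda>x. (h x)\<^sup>2) = 0"
    using 0 I_eq_HK[OF cell_integrable_continuous[OF c]] by (simp add: cell_def)
  then have "\<forall>x\<in>cbox 0 (\<chi> i. L). (h x)\<^sup>2 = 0"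
    using integral_cbox_eq_0_iff[of 0 "\<chi> i. L" "\<lambda>x. (h x)\<^sup>2"] continuous_on_subset[OF c] cell_nonempty by auto
  moreover obtain y where "y \<in> cell L" "h x = h y" using periodic_representative h by blast
  ultimately show ?thesis by (simp add: cell_def)
qed

text \<open>
  Demanding that \<open>h\<close> be orthogonal to \<open>q\<close> times every plane wave, and not only to \<open>q\<close>, makes the property stable
  under multiplication by plane waves, hence by all polynomials in the circle coordinates.
\<close>

definition annihilates :: "(real^3 \<Rightarrow> real) \<Rightarrow> (real^3 \<Rightarrow> real) \<Rightarrow> bool" where
  "annihilates h q \<longleftrightarrow> continuous_on UNIV q \<and>
     (\<forall>k. ccoef (\<lambda>x. h x * q x) k = 0 \<and> scoef (\<lambda>x. h x * q x) k = 0)"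

lemma cell_integrable_cont_mult_cos: "continuous_on UNIV f \<Longrightarrow> cell_integrable (\<lambda>x. f x * cos (wave k \<bullet> x))"
  and cell_integrable_cont_mult_sin: "continuous_on UNIV f \<Longrightarrow> cell_integrable (\<lambda>x. f x * sin (wave k \<bullet> x))"
  by (intro cell_integrable_continuous continuous_intros; assumption)+

lemma annihilates_add:
  assumes "continuous_on UNIV h" "annihilates h q" "annihilates h r"
  shows "annihilates h (\<lambda>x. q x + r x)"
proof -
  have c: "continuous_on UNIV (\<lambda>x. h x * q x)" "continuous_on UNIV (\<lambda>x. h x * r x)"
    using assms by (auto simp: annihilates_def intro!: continuous_intros)
  show ?thesis
    using assms cell_integrable_cont_mult_cos[OF c(1)] cell_integrable_cont_mult_cos[OF c(2)] cell_integrable_cont_mult_sin[OF c(1)] cell_integrable_cont_mult_sin[OF c(2)]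
    by (auto simp: annihilates_def ccoef_def scoef_def distrib_left distrib_right intro!: continuous_intros)
qed

lemma annihilates_scale:
  assumes "annihilates h q"
  shows "annihilates h (\<lambda>x. c * q x)"
  using assms by (auto simp: annihilates_def ccoef_def scoef_def mult.left_commute[of _ c] mult.assoc intro!: continuous_intros)

lemma annihilates_sum:
  assumes "continuous_on UNIV h" "\<And>j. j \<in> J \<Longrightarrow> annihilates h (q j)"
  shows "annihilates h (\<lambda>x. \<Sum>j\<in>J. q j x)"
  using assms(2)
proof (induction J rule: infinite_finite_induct)
  case (insert j J)
  then show ?case using annihilates_add[OF assms(1)] by simp
qed (auto simp: annihilates_def ccoef_def scoef_def)

lemma annihilates_cos_sin:
  assumes h: "continuous_on UNIV h" and q: "annihilates h q"
  shows "annihilates h (\<lambda>x. cos (wave l \<bullet> x) * q x)" "annihilates h (\<lambda>x. sin (wave l \<bullet> x) * q x)"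
proof -
  let ?p = "\<lambda>x. h x * q x"
  have cp: "continuous_on UNIV ?p" using h q by (auto simp: annihilates_def intro!: continuous_intros)
  note int = cell_integrable_cont_mult_cos[OF cp] cell_integrable_cont_mult_sin[OF cp]
  have 0: "I (\<lambda>x. ?p x * cos (wave k \<bullet> x)) = 0" "I (\<lambda>x. ?p x * sin (wave k \<bullet> x)) = 0" for k
    using q by (auto simp: annihilates_def ccoef_def scoef_def)
  have e: "h x * (cos (wave l \<bullet> x) * q x) * cos (wave k \<bullet> x)
        = (?p x * cos (wave (l - k) \<bullet> x) + ?p x * cos (wave (l + k) \<bullet> x)) / 2"
     "h x * (cos (wave l \<bullet> x) * q x) * sin (wave k \<bullet> x)
        = (?p x * sin (wave (l + k) \<bullet> x) - ?p x * sin (wave (l - k) \<bullet> x)) / 2"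
     "h x * (sin (wave l \<bullet> x) * q x) * cos (wave k \<bullet> x)
        = (?p x * sin (wave (l + k) \<bullet> x) + ?p x * sin (wave (l - k) \<bullet> x)) / 2"
     "h x * (sin (wave l \<bullet> x) * q x) * sin (wave k \<bullet> x)
        = (?p x * cos (wave (l - k) \<bullet> x) - ?p x * cos (wave (l + k) \<bullet> x)) / 2" for k x
    by (simp_all add: wave_diff wave_add inner_diff_left inner_add_left cos_add sin_add cos_diff sin_diff algebra_simps)
  have c: "continuous_on UNIV (\<lambda>x. cos (wave l \<bullet> x) * q x)" "continuous_on UNIV (\<lambda>x. sin (wave l \<bullet> x) * q x)"
    using q by (auto simp: annihilates_def intro!: continuous_intros)
  show "annihilates h (\<lambda>x. cos (wave l \<bullet> x) * q x)" "annihilates h (\<lambda>x. sin (wave l \<bullet> x) * q x)"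
    unfolding annihilates_def ccoef_def scoef_def e using c int 0 by simp_all
qed

lemma annihilates_polynomial:
  assumes h: "continuous_on UNIV h" and "real_polynomial_function g" and "annihilates h q"
  shows "annihilates h (\<lambda>x. g (circle_coords x) * q x)"
  using assms(2,3)
proof (induction g arbitrary: q rule: real_polynomial_function.induct)
  case (linear g)
  interpret g: bounded_linear g by fact
  have split: "g (circle_coords x) = (\<Sum>i\<in>UNIV. cos (wave (axis i 1) \<bullet> x) * g (axis i 1, 0))
       + (\<Sum>i\<in>UNIV. sin (wave (axis i 1) \<bullet> x) * g (0, axis i 1))" for x
  proof -
    have "circle_coords x = (\<Sum>i\<in>UNIV. cos (wave (axis i 1) \<bullet> x) *\<^sub>R (axis i 1, 0))
       + (\<Sum>i\<in>UNIV. sin (wave (axis i 1) \<bullet> x) *\<^sub>R (0, axis i 1))"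
      by (auto simp: circle_coords_def prod_eq_iff fst_sum snd_sum vec_eq_iff axis_def if_distrib cong: if_cong)
    then show ?thesis by (simp only: g.add g.sum g.scaleR real_scaleR_def)
  qed
  have eq: "(\<lambda>x. g (circle_coords x) * q x) = (\<lambda>x.
      (\<Sum>i\<in>UNIV. g (axis i 1, 0) * (cos (wave (axis i 1) \<bullet> x) * q x))
    + (\<Sum>i\<in>UNIV. g (0, axis i 1) * (sin (wave (axis i 1) \<bullet> x) * q x)))"
    unfolding split by (simp add: distrib_left sum_distrib_left mult_ac)
  show ?case unfolding eq
    by (intro annihilates_add annihilates_sum annihilates_scale annihilates_cos_sin h linear)
next
  case (const c)
  then show ?case by (simp add: annihilates_scale)
next
  case (add f g)
  then show ?case using annihilates_add[OF h] by (simp add: distrib_right)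
next
  case (mult f g)
  then show ?case by (simp add: mult.assoc)
qed

text \<open>
  Such a function is orthogonal to all trigonometric polynomials, and these approximate it uniformly, so it
  is orthogonal to itself. To approximate it, it is carried over to the product of circles, where it is
  continuous because the map from the compact cell onto it is a quotient map.
\<close>

lemma fourier_unique:
  assumes h: "continuous_on UNIV h" "periodic L h"
    and c: "\<And>k. ccoef h k = 0" and s: "\<And>k. scoef h k = 0"
  shows "h x = 0"
proof -
  let ?S = "circle_coords ` cell L"
  define H where "H z = h (inv_into (cell L) circle_coords z)" for z
  have comp: "compact (cell L)" by (simp add: cell_def)
  have H: "H (circle_coords x) = h x" if "x \<in> cell L" for x
    unfolding H_def
    by (rule circle_coords_eqD[OF _ h(2)]) (use that in \<open>simp add: f_inv_into_f\<close>)
  have qm: "quotient_map (top_of_set (cell L)) (top_of_set ?S) circle_coords"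
    by (rule T1_Spaces.continuous_imp_quotient_map)
       (auto simp: continuous_circle_coords comp compact_space_subtopology Hausdorff_space_subtopology)
  have "continuous_map (top_of_set (cell L)) euclidean (H \<circ> circle_coords)"
    using continuous_on_subset[OF h(1)] H by (auto cong: continuous_on_cong)
  from continuous_compose_quotient_map[OF qm this] have Hc: "continuous_on ?S H" by simp
  have cS: "compact ?S" by (rule compact_continuous_image[OF continuous_circle_coords comp])
  \<comment> \<open>The constant function is annihilated by assumption, and polynomials preserve this.\<close>
  have ann1: "annihilates h (\<lambda>_. 1)" using c s by (simp add: annihilates_def)
  have hint: "cell_integrable h" "cell_integrable (\<lambda>x. (h x)\<^sup>2)" "cell_integrable (\<lambda>x. \<bar>h x\<bar>)"
    by (intro cell_integrable_continuous continuous_intros h)+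
  have "I (\<lambda>x. (h x)\<^sup>2) \<le> e * I (\<lambda>x. \<bar>h x\<bar>)" if e: "e > 0" for e
  proof -
    obtain g where g: "real_polynomial_function g" "\<And>z. z \<in> ?S \<Longrightarrow> \<bar>H z - g z\<bar> < e"
      using Stone_Weierstrass_real_polynomial_function[OF cS Hc e] by blast
    have ann: "annihilates h (\<lambda>x. g (circle_coords x) * 1)"
      by (rule annihilates_polynomial[OF h(1) g(1) ann1])
    then have g0: "I (\<lambda>x. h x * g (circle_coords x)) = 0"
      unfolding annihilates_def ccoef_def by (auto dest!: spec[of _ 0])
    have gc: "cell_integrable (\<lambda>x. h x * g (circle_coords x))"
      using ann by (intro cell_integrable_continuous continuous_intros h) (simp add: annihilates_def)
    have "I (\<lambda>x. (h x)\<^sup>2) = I (\<lambda>x. (h x)\<^sup>2 - h x * g (circle_coords x))"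
      using hint gc g0 by simp
    also have "\<dots> \<le> I (\<lambda>x. e * \<bar>h x\<bar>)"
    proof (rule integral_mono)
      fix x assume "x \<in> space (lebesgue_on (cell L))"
      then have x: "x \<in> cell L" by (simp add: cell_def)
      have "(h x)\<^sup>2 - h x * g (circle_coords x) = h x * (H (circle_coords x) - g (circle_coords x))"
        using H[OF x] by (simp add: power2_eq_square algebra_simps)
      also have "\<dots> \<le> \<bar>h x\<bar> * \<bar>H (circle_coords x) - g (circle_coords x)\<bar>"
        by (metis abs_ge_self abs_mult)
      also have "\<dots> \<le> \<bar>h x\<bar> * e"
        using g(2)[of "circle_coords x"] x by (intro mult_left_mono) auto
      finally show "(h x)\<^sup>2 - h x * g (circle_coords x) \<le> e * \<bar>h x\<bar>" by (simp add: mult.commute)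
    qed (use hint gc in auto)
    finally show ?thesis by simp
  qed
  then have "I (\<lambda>x. (h x)\<^sup>2) \<le> 0"
  proof -
    assume *: "\<And>e. e > 0 \<Longrightarrow> I (\<lambda>x. (h x)\<^sup>2) \<le> e * I (\<lambda>x. \<bar>h x\<bar>)"
    have "((\<lambda>e. e * I (\<lambda>x. \<bar>h x\<bar>)) \<longlongrightarrow> 0 * I (\<lambda>x. \<bar>h x\<bar>)) (at_right 0)"
      by (intro tendsto_intros)
    then show ?thesis
      using * by (intro tendsto_lowerbound[of _ _ "at_right 0"]) (auto simp: eventually_at_right_less intro!: eventually_at_rightI[of 0 1])
  qed
  moreover have "0 \<le> I (\<lambda>x. (h x)\<^sup>2)" by (rule integral_nonneg_AE) simp
  ultimately show ?thesis using I_square_eq_0[OF h] by simp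
qed

end

section \<open>Summability of Fourier coefficients in the Sobolev space\<close>

context periodic_box
begin

text \<open>
  Third derivatives in a single direction suffice to control all derivatives up to order three, so the
  mixed ones are left out.
\<close>

definition sobolev_weight :: "int^3 \<Rightarrow> real" where
  "sobolev_weight k = 1 + (\<Sum>i\<in>UNIV. (wave k $ i) ^ 6)"

text \<open>
  A summable weight of order \<open>|k|\<^sup>-\<^sup>4\<close>. Its product form makes the sum over a cube the third power of a
  one-dimensional sum, which converges since \<open>4/3 > 1\<close>.
\<close>

definition lattice_weight :: "int^3 \<Rightarrow> real" where
  "lattice_weight k = (\<Prod>i\<in>UNIV. (1 + \<bar>real_of_int (k $ i)\<bar>) powr - (4 / 3))"

lemma lattice_weight_pos: "lattice_weight k > 0"
  unfolding lattice_weight_def by (intro prod_pos) (auto intro: add_pos_nonneg)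

lemma sobolev_weight_ge: "1 \<le> sobolev_weight k" "(wave k $ i) ^ 6 \<le> sobolev_weight k"
proof -
  have nn: "0 \<le> (wave k $ j) ^ 6" for j by simp
  then have "0 \<le> (\<Sum>i\<in>UNIV. (wave k $ i) ^ 6)" by (intro sum_nonneg)
  moreover have "(wave k $ i) ^ 6 \<le> (\<Sum>i\<in>UNIV. (wave k $ i) ^ 6)"
    by (rule member_le_sum) (auto simp: nn)
  ultimately show "1 \<le> sobolev_weight k" "(wave k $ i) ^ 6 \<le> sobolev_weight k"
    by (simp_all add: sobolev_weight_def)
qed

lemma sum_lattice_weight_cube:
  "sum lattice_weight (cube N) = (\<Sum>n\<in>{- int N..int N}. (1 + \<bar>real_of_int n\<bar>) powr - (4 / 3)) ^ 3"
proof -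
  let ?f = "\<lambda>n::int. (1 + \<bar>real_of_int n\<bar>) powr - (4 / 3)"
  have "(\<Sum>n\<in>{- int N..int N}. ?f n) ^ 3 = (\<Prod>i\<in>(UNIV::3 set). \<Sum>n\<in>{- int N..int N}. ?f n)"
    by simp
  also have "\<dots> = (\<Sum>g\<in>PiE (UNIV::3 set) (\<lambda>_. {- int N..int N}). \<Prod>i\<in>UNIV. ?f (g i))"
    by (rule prod_sum_PiE) auto
  also have "\<dots> = sum lattice_weight (cube N)"
    unfolding cube_eq lattice_weight_def
    by (subst sum.reindex) (auto simp: inj_on_def vec_eq_iff)
  finally show ?thesis ..
qed

lemma sum_lattice_weight_bounded: "\<exists>B. \<forall>N. sum lattice_weight (cube N) \<le> B"
proof -
  let ?g = "\<lambda>n. (1 + real n) powr - (4 / 3)"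
  have summ: "summable ?g"
  proof -
    have "summable (\<lambda>n. real n powr - (4 / 3))" by (simp add: summable_real_powr_iff)
    then have "summable (\<lambda>n. real (Suc n) powr - (4 / 3))" by (subst summable_Suc_iff)
    then show ?thesis by (simp add: add.commute)
  qed
  let ?f = "\<lambda>n::int. (1 + \<bar>real_of_int n\<bar>) powr - (4 / 3)"
  have half: "(\<Sum>n\<in>{0..int N}. ?f n) \<le> suminf ?g" for N
  proof -
    have "(\<Sum>n\<in>{0..int N}. ?f n) = (\<Sum>n\<in>{..N}. ?g n)"
      by (rule sum.reindex_bij_witness[of _ int nat]) auto
    also have "\<dots> \<le> suminf ?g" by (rule sum_le_suminf[OF summ]) auto
    finally show ?thesis .
  qed
  have "(\<Sum>n\<in>{- int N..int N}. ?f n) \<le> 2 * suminf ?g" for N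
  proof -
    have "(\<Sum>n\<in>{- int N..int N}. ?f n) \<le> (\<Sum>n\<in>{- int N..0} \<union> {0..int N}. ?f n)"
      by (rule sum_mono2) auto
    also have "\<dots> \<le> (\<Sum>n\<in>{- int N..0}. ?f n) + (\<Sum>n\<in>{0..int N}. ?f n)"
      by (subst sum_Un) (auto intro!: sum_nonneg)
    also have "(\<Sum>n\<in>{- int N..0}. ?f n) = (\<Sum>n\<in>{0..int N}. ?f n)"
      by (rule sum.reindex_bij_witness[of _ uminus uminus]) auto
    finally show ?thesis using half[of N] by simp
  qed
  moreover have "0 \<le> (\<Sum>n\<in>{- int N..int N}. ?f n)" for N by (rule sum_nonneg) auto
  ultimately have "sum lattice_weight (cube N) \<le> (2 * suminf ?g) ^ 3" for N
    unfolding sum_lattice_weight_cube by (intro power_mono)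
  then show ?thesis by blast
qed

definition lattice_total :: real where
  "lattice_total = lim (\<lambda>N. sum lattice_weight (cube N))"

lemma incseq_lattice: "incseq (\<lambda>N. sum lattice_weight (cube N))"
  by (intro monoI sum_mono2 finite_cube cube_mono) (auto intro: less_imp_le lattice_weight_pos)

lemma lattice_total_lim: "(\<lambda>N. sum lattice_weight (cube N)) \<longlonglongrightarrow> lattice_total"
proof -
  obtain B where "\<And>N. sum lattice_weight (cube N) \<le> B" using sum_lattice_weight_bounded by blast
  then obtain l where "(\<lambda>N. sum lattice_weight (cube N)) \<longlonglongrightarrow> l"
    using incseq_convergent[OF incseq_lattice] by metis
  then show ?thesis unfolding lattice_total_def by (simp add: limI)
qed

lemma lattice_le_total: "sum lattice_weight (cube N) \<le> lattice_total"
  by (rule incseq_le[OF incseq_lattice lattice_total_lim])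

text \<open>
  The constant of the comparison of weights below: the first factor bounds the wave vector by its index, \<open>64\<close>
  comes from \<open>(1 + n)\<^sup>6 \<le> 64 (1 + n\<^sup>6)\<close>, and the last factor returns from the index to the wave vector.
\<close>

definition embedding_const :: real where
  "embedding_const = (1 + 2 * pi / L)\<^sup>2 * 64 * (1 + 1 / (2 * pi / L) ^ 6)"

lemma embedding_const_pos: "embedding_const > 0"
proof -
  show ?thesis unfolding embedding_const_def using L_pos
    by (intro mult_pos_pos zero_less_power add_pos_pos divide_pos_pos) auto
qed

text \<open>
  Both sides are compared with powers of the largest absolute value \<open>n\<close> of a coordinate of \<open>k\<close>: the left-hand side is of order
  \<open>(1 + n)\<^sup>2\<close>, the lattice weight is at least \<open>(1 + n)\<^sup>-\<^sup>4\<close>, and the Sobolev weight is of order \<open>(1 + n)\<^sup>6\<close>.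
\<close>

lemma weight_inequality:
  "(1 + \<bar>wave k $ i\<bar>)\<^sup>2 \<le> embedding_const * lattice_weight k * sobolev_weight k"
proof -
  define \<omega> where "\<omega> = 2 * pi / L"
  have \<omega>: "\<omega> > 0" using L_pos by (simp add: \<omega>_def)
  define n where "n = Max (range (\<lambda>j. \<bar>real_of_int (k $ j)\<bar>))"
  have "n \<in> range (\<lambda>j. \<bar>real_of_int (k $ j)\<bar>)" unfolding n_def by (rule Max_in) auto
  then obtain j where j: "n = \<bar>real_of_int (k $ j)\<bar>" by blast
  have le: "\<bar>real_of_int (k $ l)\<bar> \<le> n" for l unfolding n_def by (rule Max_ge) auto
  have n0: "n \<ge> 0" using j by simp
  have lw: "(1 + n) ^ 4 * lattice_weight k \<ge> 1"
  proof -
    have "(\<Prod>l\<in>(UNIV::3 set). (1 + n) powr - (4 / 3)) \<le> lattice_weight k"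
      unfolding lattice_weight_def
      by (intro prod_mono conjI powr_mono2') (use le in \<open>auto intro: add_pos_nonneg\<close>)
    moreover have "(\<Prod>l\<in>(UNIV::3 set). (1 + n) powr - (4 / 3)) = 1 / (1 + n) ^ 4"
    proof -
      have "(\<Prod>l\<in>(UNIV::3 set). (1 + n) powr - (4 / 3)) = ((1 + n) powr - (4 / 3)) ^ 3"
        by simp
      also have "\<dots> = ((1 + n) powr - (4 / 3)) powr (real 3)"
        using n0 by (subst powr_realpow) auto
      also have "\<dots> = (1 + n) powr - (real 4)" by (simp add: powr_powr)
      also have "\<dots> = 1 / (1 + n) ^ 4"
        unfolding powr_minus_divide using n0 by (subst powr_realpow) auto
      finally show ?thesis .
    qed
    ultimately have "1 / (1 + n) ^ 4 \<le> lattice_weight k" by (simp only:)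
    then show ?thesis using n0 by (simp add: pos_divide_le_eq mult.commute)
  qed
  have "(1 + n) ^ 6 \<le> 64 * (1 + n ^ 6)"
  proof (cases "n \<ge> 1")
    case True
    then have "(1 + n) ^ 6 \<le> (2 * n) ^ 6" by (intro power_mono) auto
    then show ?thesis by (simp add: power_mult_distrib)
  next
    case False
    then have "(1 + n) ^ 6 \<le> 64" using power_mono[of "1 + n" 2 6] n0 by simp
    also have "64 \<le> 64 * (1 + n ^ 6)" using n0 by simp
    finally show ?thesis .
  qed
  also have "\<dots> \<le> 64 * ((1 + 1 / \<omega> ^ 6) * sobolev_weight k)"
  proof -
    have "\<omega> * n = \<bar>wave k $ j\<bar>"
      using L_pos by (simp add: j wave_nth \<omega>_def abs_mult)
    then have "(\<omega> * n) ^ 6 = (wave k $ j) ^ 6"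
      by (simp add: power_even_abs)
    then have "\<omega> ^ 6 * n ^ 6 \<le> sobolev_weight k"
      using sobolev_weight_ge(2)[of k j] by (simp add: power_mult_distrib)
    then have "n ^ 6 \<le> 1 / \<omega> ^ 6 * sobolev_weight k" using \<omega> by (simp add: field_simps)
    then show ?thesis using sobolev_weight_ge(1)[of k] by (simp add: distrib_right)
  qed
  finally have n6: "(1 + n) ^ 6 \<le> 64 * ((1 + 1 / \<omega> ^ 6) * sobolev_weight k)" .
  have "1 + \<bar>wave k $ i\<bar> \<le> (1 + \<omega>) * (1 + n)"
  proof -
    have "\<bar>wave k $ i\<bar> = \<omega> * \<bar>real_of_int (k $ i)\<bar>" using L_pos by (simp add: wave_nth \<omega>_def abs_mult)
    also have "\<dots> \<le> \<omega> * n" using le \<omega> by (intro mult_left_mono) auto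
    finally show ?thesis using n0 \<omega> by (simp add: algebra_simps)
  qed
  then have "(1 + \<bar>wave k $ i\<bar>)\<^sup>2 \<le> ((1 + \<omega>) * (1 + n))\<^sup>2" by (intro power_mono) auto
  also have "\<dots> \<le> ((1 + \<omega>) * (1 + n))\<^sup>2 * ((1 + n) ^ 4 * lattice_weight k)"
    using mult_left_mono[OF lw, of "((1 + \<omega>) * (1 + n))\<^sup>2"] by simp
  also have "\<dots> = (1 + \<omega>)\<^sup>2 * lattice_weight k * (1 + n) ^ 6"
    using power_add[of "1 + n" 2 4] by (simp add: power_mult_distrib)
  also have "\<dots> \<le> (1 + \<omega>)\<^sup>2 * lattice_weight k * (64 * ((1 + 1 / \<omega> ^ 6) * sobolev_weight k))"
    using lattice_weight_pos[of k] n6 by (intro mult_left_mono) auto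
  finally show ?thesis unfolding embedding_const_def \<omega>_def by (simp only: mult_ac)
qed

definition amplitude :: "(real^3 \<Rightarrow> real) \<Rightarrow> int^3 \<Rightarrow> real" where
  "amplitude u k = sqrt ((ccoef u k)\<^sup>2 + (scoef u k)\<^sup>2)"

lemma amplitude_nonneg: "amplitude u k \<ge> 0" and amplitude_sq: "(amplitude u k)\<^sup>2 = (ccoef u k)\<^sup>2 + (scoef u k)\<^sup>2"
  by (simp_all add: amplitude_def)

definition sobolev_energy :: "nat \<Rightarrow> (real^3 \<Rightarrow> real) \<Rightarrow> real" where
  "sobolev_energy N u = (\<Sum>k\<in>cube N. sobolev_weight k * (amplitude u k)\<^sup>2)"

text \<open>
  The factor by which the \<open>H\<^sup>3\<close> norm bounds the part of the Fourier series outside a cube; it is independent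
  of the function.
\<close>

definition lattice_tail :: "nat \<Rightarrow> real" where
  "lattice_tail N = sqrt (embedding_const * (lattice_total - sum lattice_weight (cube N)))"

lemma lattice_tail_lim: "lattice_tail \<longlonglongrightarrow> 0"
proof -
  have "(\<lambda>N. sqrt (embedding_const * (lattice_total - sum lattice_weight (cube N))))
      \<longlonglongrightarrow> sqrt (embedding_const * (lattice_total - lattice_total))"
    by (intro tendsto_intros lattice_total_lim)
  then show ?thesis by (simp add: lattice_tail_def[abs_def])
qed

lemma lattice_tail_nonneg: "lattice_tail N \<ge> 0"
  unfolding lattice_tail_def using lattice_le_total embedding_const_pos by (simp add: less_imp_le)

text \<open>
  The Cauchy--Schwarz inequality with weights: finite \<open>H\<^sup>3\<close> energy makes the Fourier coefficients of the
  function and of its gradient absolutely summable. The summand \<open>1\<close> serves the function, \<open>|wave k $ i|\<close> its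
  partial derivatives.
\<close>

lemma weighted_Cauchy_Schwarz:
  assumes "finite F" "F \<subseteq> cube M" and e: "sobolev_energy M u \<le> Q\<^sup>2" and Q: "Q \<ge> 0"
    and W: "sum lattice_weight F \<le> W"
  shows "(\<Sum>k\<in>F. (1 + \<bar>wave k $ i\<bar>) * amplitude u k) \<le> Q * sqrt (embedding_const * W)"
proof (rule power2_le_imp_le)
  let ?a = "\<lambda>k. (1 + \<bar>wave k $ i\<bar>) / sqrt (sobolev_weight k)"
  let ?b = "\<lambda>k. sqrt (sobolev_weight k) * amplitude u k"
  have sw: "sobolev_weight k > 0" for k using sobolev_weight_ge(1)[of k] by simp
  have W0: "0 \<le> W" using sum_nonneg[of F lattice_weight] W less_imp_le[OF lattice_weight_pos] by auto
  have eq: "(\<Sum>k\<in>F. (1 + \<bar>wave k $ i\<bar>) * amplitude u k) = (\<Sum>k\<in>F. ?a k * ?b k)"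
  proof (intro sum.cong refl)
    fix k
    have "sqrt (sobolev_weight k) \<noteq> 0" using sw[of k] by simp
    then show "(1 + \<bar>wave k $ i\<bar>) * amplitude u k = ?a k * ?b k" by simp
  qed
  have "(\<Sum>k\<in>F. (1 + \<bar>wave k $ i\<bar>) * amplitude u k)\<^sup>2 \<le> (\<Sum>k\<in>F. (?a k)\<^sup>2) * (\<Sum>k\<in>F. (?b k)\<^sup>2)"
    unfolding eq by (rule Cauchy_Schwarz_ineq_sum)
  also have "\<dots> \<le> (embedding_const * W) * Q\<^sup>2"
  proof (rule mult_mono)
    have "(?a k)\<^sup>2 \<le> embedding_const * lattice_weight k" for k
      using weight_inequality[of k i] sw[of k] by (simp add: power_divide pos_divide_le_eq)
    then have "(\<Sum>k\<in>F. (?a k)\<^sup>2) \<le> embedding_const * sum lattice_weight F"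
      unfolding sum_distrib_left by (intro sum_mono)
    also have "\<dots> \<le> embedding_const * W" using W embedding_const_pos by simp
    finally show "(\<Sum>k\<in>F. (?a k)\<^sup>2) \<le> embedding_const * W" .
    have "(\<Sum>k\<in>F. (?b k)\<^sup>2) = (\<Sum>k\<in>F. sobolev_weight k * (amplitude u k)\<^sup>2)"
      using sw by (intro sum.cong) (auto simp: power_mult_distrib less_imp_le)
    also have "\<dots> \<le> sobolev_energy M u" unfolding sobolev_energy_def
      using assms(2) sw by (intro sum_mono2 finite_cube) (auto simp: less_imp_le)
    finally show "(\<Sum>k\<in>F. (?b k)\<^sup>2) \<le> Q\<^sup>2" using e by simp
  qed (use embedding_const_pos W0 in \<open>auto intro: sum_nonneg\<close>)
  also have "\<dots> = (Q * sqrt (embedding_const * W))\<^sup>2"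
    using embedding_const_pos W0 by (simp add: power_mult_distrib)
  finally show "(\<Sum>k\<in>F. (1 + \<bar>wave k $ i\<bar>) * amplitude u k)\<^sup>2 \<le> (Q * sqrt (embedding_const * W))\<^sup>2" .
  show "0 \<le> Q * sqrt (embedding_const * W)" using Q embedding_const_pos W0 by simp
qed

lemma lattice_tail_sum_le:
  assumes "N \<le> M" "sobolev_energy M u \<le> Q\<^sup>2" "Q \<ge> 0"
  shows "(\<Sum>k\<in>cube M - cube N. (1 + \<bar>wave k $ i\<bar>) * amplitude u k) \<le> Q * lattice_tail N"
  unfolding lattice_tail_def
proof (rule weighted_Cauchy_Schwarz[OF _ _ assms(2,3)])
  show "sum lattice_weight (cube M - cube N) \<le> lattice_total - sum lattice_weight (cube N)"
    using sum_diff[OF finite_cube cube_mono[OF assms(1)], of lattice_weight] lattice_le_total[of M] by simp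
qed (auto simp: finite_cube)

definition sup_const :: real where
  "sup_const = sqrt (embedding_const * lattice_total)"

lemma full_sum_le:
  assumes "sobolev_energy M u \<le> Q\<^sup>2" "Q \<ge> 0"
  shows "(\<Sum>k\<in>cube M. (1 + \<bar>wave k $ i\<bar>) * amplitude u k) \<le> Q * sup_const"
  unfolding sup_const_def
  by (rule weighted_Cauchy_Schwarz[OF _ _ assms]) (auto simp: finite_cube lattice_le_total)

lemma cos_sin_combination_le: "\<bar>a * cos t + b * sin t\<bar> \<le> sqrt (a\<^sup>2 + b\<^sup>2)"
proof (rule real_le_rsqrt[THEN ord_eq_le_trans[OF refl]])
  have "0 \<le> (a * sin t - b * cos t)\<^sup>2" by simp
  moreover
  have "(a * cos t + b * sin t)\<^sup>2 + (a * sin t - b * cos t)\<^sup>2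
      = (a\<^sup>2 + b\<^sup>2) * ((sin t)\<^sup>2 + (cos t)\<^sup>2)"
    by algebra
  then have "(a * cos t + b * sin t)\<^sup>2 + (a * sin t - b * cos t)\<^sup>2 = a\<^sup>2 + b\<^sup>2" by simp
  ultimately have "(a * cos t + b * sin t)\<^sup>2 \<le> a\<^sup>2 + b\<^sup>2" by linarith
  then show "\<bar>a * cos t + b * sin t\<bar>\<^sup>2 \<le> a\<^sup>2 + b\<^sup>2" by simp
qed

lemma mode_le:
  "\<bar>ccoef u k / L ^ 3 * cos t + scoef u k / L ^ 3 * sin t\<bar> \<le> (1 + \<bar>wave k $ i\<bar>) * amplitude u k / L ^ 3"
  "\<bar>wave k $ i * (scoef u k / L ^ 3) * cos t + - (wave k $ i * (ccoef u k / L ^ 3)) * sin t\<bar>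
     \<le> (1 + \<bar>wave k $ i\<bar>) * amplitude u k / L ^ 3"
proof -
  have a: "amplitude u k \<ge> 0" by (rule amplitude_nonneg)
  have "ccoef u k / L ^ 3 * cos t + scoef u k / L ^ 3 * sin t = (ccoef u k * cos t + scoef u k * sin t) / L ^ 3"
    by (simp add: add_divide_distrib)
  then have "\<bar>ccoef u k / L ^ 3 * cos t + scoef u k / L ^ 3 * sin t\<bar> \<le> amplitude u k / L ^ 3"
    using cos_sin_combination_le[of "ccoef u k" t "scoef u k"] L_pos
    by (simp add: amplitude_def divide_right_mono)
  also have "\<dots> \<le> (1 + \<bar>wave k $ i\<bar>) * amplitude u k / L ^ 3"
    using a L_pos by (intro divide_right_mono) (auto simp: algebra_simps)
  finally show "\<bar>ccoef u k / L ^ 3 * cos t + scoef u k / L ^ 3 * sin t\<bar> \<le> (1 + \<bar>wave k $ i\<bar>) * amplitude u k / L ^ 3" .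
  have "wave k $ i * (scoef u k / L ^ 3) * cos t + - (wave k $ i * (ccoef u k / L ^ 3)) * sin t
      = wave k $ i * (scoef u k * cos t + (- ccoef u k) * sin t) / L ^ 3"
    by (simp add: diff_divide_distrib algebra_simps)
  also have "\<bar>\<dots>\<bar> = \<bar>wave k $ i\<bar> * \<bar>scoef u k * cos t + (- ccoef u k) * sin t\<bar> / L ^ 3"
    using L_pos by (simp add: abs_mult)
  also have "\<dots> \<le> \<bar>wave k $ i\<bar> * amplitude u k / L ^ 3"
    using cos_sin_combination_le[of "scoef u k" t "- ccoef u k"] L_pos
    by (intro divide_right_mono mult_left_mono) (auto simp: amplitude_def add.commute)
  also have "\<dots> \<le> (1 + \<bar>wave k $ i\<bar>) * amplitude u k / L ^ 3"
    using a L_pos by (intro divide_right_mono) (auto simp: algebra_simps)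
  finally show "\<bar>wave k $ i * (scoef u k / L ^ 3) * cos t + - (wave k $ i * (ccoef u k / L ^ 3)) * sin t\<bar>
     \<le> (1 + \<bar>wave k $ i\<bar>) * amplitude u k / L ^ 3" .
qed

lemma psum_tail:
  assumes "N \<le> M" "sobolev_energy M u \<le> Q\<^sup>2" "Q \<ge> 0"
  shows "\<bar>psum M u x - psum N u x\<bar> \<le> Q * lattice_tail N / L ^ 3"
    and "\<bar>pd i (psum M u) x - pd i (psum N u) x\<bar> \<le> Q * lattice_tail N / L ^ 3"
proof -
  have diff: "trig (cube M) a b x - trig (cube N) a b x = trig (cube M - cube N) a b x" for a b
    unfolding trig_def by (rule sum_diff[OF finite_cube cube_mono[OF assms(1)], symmetric])
  have s: "(\<Sum>k\<in>cube M - cube N. (1 + \<bar>wave k $ j\<bar>) * amplitude u k / L ^ 3) \<le> Q * lattice_tail N / L ^ 3" for j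
    using lattice_tail_sum_le[OF assms, of j] L_pos by (simp add: divide_right_mono flip: sum_divide_distrib)
  show "\<bar>psum M u x - psum N u x\<bar> \<le> Q * lattice_tail N / L ^ 3"
    unfolding psum_def diff unfolding trig_def
    by (rule order_trans[OF sum_abs order_trans[OF sum_mono s[of i]]]) (rule mode_le)
  show "\<bar>pd i (psum M u) x - pd i (psum N u) x\<bar> \<le> Q * lattice_tail N / L ^ 3"
    unfolding psum_def pd_trig diff unfolding trig_def
    by (rule order_trans[OF sum_abs order_trans[OF sum_mono s[of i]]]) (rule mode_le)
qed

lemma psum_bound:
  assumes "sobolev_energy M u \<le> Q\<^sup>2" "Q \<ge> 0"
  shows "\<bar>psum M u x\<bar> \<le> Q * sup_const / L ^ 3"
    and "\<bar>pd i (psum M u) x\<bar> \<le> Q * sup_const / L ^ 3"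
proof -
  have s: "(\<Sum>k\<in>cube M. (1 + \<bar>wave k $ j\<bar>) * amplitude u k / L ^ 3) \<le> Q * sup_const / L ^ 3" for j
    using full_sum_le[OF assms, of j] L_pos by (simp add: divide_right_mono flip: sum_divide_distrib)
  show "\<bar>psum M u x\<bar> \<le> Q * sup_const / L ^ 3"
    unfolding psum_def trig_def
    by (rule order_trans[OF sum_abs order_trans[OF sum_mono s[of i]]]) (rule mode_le)
  show "\<bar>pd i (psum M u) x\<bar> \<le> Q * sup_const / L ^ 3"
    unfolding psum_def pd_trig trig_def
    by (rule order_trans[OF sum_abs order_trans[OF sum_mono s[of i]]]) (rule mode_le)
qed

text \<open>
  The second derivatives of the partial sums need not converge uniformly, but they stay bounded in \<open>L\<^sup>2\<close>,
  since \<open>y\<^sup>4 \<le> 1 + y\<^sup>6\<close>.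
\<close>

lemma psum_second_derivative_L2:
  assumes "sobolev_energy N u \<le> Q\<^sup>2"
  shows "I (\<lambda>x. (pd i (pd i (psum N u)) x)\<^sup>2) \<le> Q\<^sup>2 / L ^ 3"
proof -
  let ?a = "\<lambda>k. - ((wave k $ i)\<^sup>2 * (ccoef u k / L ^ 3))"
  let ?b = "\<lambda>k. - ((wave k $ i)\<^sup>2 * (scoef u k / L ^ 3))"
  have eq: "pd i (pd i (psum N u)) = trig (cube N) ?a ?b"
    unfolding psum_def pd_trig power2_eq_square mult_minus_right mult.assoc ..
  have "I (\<lambda>x. (pd i (pd i (psum N u)) x)\<^sup>2) = I (\<lambda>x. trig (cube N) ?a ?b x * trig (cube N) ?a ?b x)"
    by (simp only: eq power2_eq_square)
  also have "\<dots> = L ^ 3 * (\<Sum>k\<in>cube N. ?a k * ?a k + ?b k * ?b k)"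
    by (rule I_trig_trig) (auto simp: finite_cube cube_uminus ccoef_uminus scoef_uminus)
  also have "\<dots> = (\<Sum>k\<in>cube N. (wave k $ i) ^ 4 * (amplitude u k)\<^sup>2) / L ^ 3"
    unfolding sum_distrib_left sum_divide_distrib
  proof (intro sum.cong refl)
    fix k
    have "c * (- (w\<^sup>2 * (x / c)) * - (w\<^sup>2 * (x / c)) + - (w\<^sup>2 * (y / c)) * - (w\<^sup>2 * (y / c)))
        = w ^ 4 * (x\<^sup>2 + y\<^sup>2) / c" if "c \<noteq> 0" for c w x y :: real
      using that by (simp add: power2_eq_square power4_eq_xxxx field_simps)
    from this[of "L ^ 3"] show "L ^ 3 * (?a k * ?a k + ?b k * ?b k) = (wave k $ i) ^ 4 * (amplitude u k)\<^sup>2 / L ^ 3"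
      unfolding amplitude_sq by this (use L_pos in simp)
  qed
  also have "\<dots> \<le> sobolev_energy N u / L ^ 3"
    unfolding sobolev_energy_def
  proof (intro divide_right_mono sum_mono mult_right_mono)
    fix k
    have "y ^ 4 \<le> 1 + y ^ 6" for y :: real
    proof (cases "\<bar>y\<bar> \<le> 1")
      case True
      then have "\<bar>y\<bar> ^ 4 \<le> 1" by (intro power_le_one) auto
      then have "y ^ 4 \<le> 1" by simp
      also have "1 \<le> 1 + y ^ 6" by simp
      finally show ?thesis .
    next
      case False
      then have "\<bar>y\<bar> ^ 4 \<le> \<bar>y\<bar> ^ 6" by (intro power_increasing) auto
      then have "y ^ 4 \<le> y ^ 6" by simp
      also have "y ^ 6 \<le> 1 + y ^ 6" by simp
      finally show ?thesis .
    qed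
    then have "(wave k $ i) ^ 4 \<le> 1 + (wave k $ i) ^ 6" .
    also have "\<dots> \<le> sobolev_weight k"
      unfolding sobolev_weight_def by (intro add_left_mono member_le_sum) auto
    finally show "(wave k $ i) ^ 4 \<le> sobolev_weight k" .
  qed (use L_pos in auto)
  also have "\<dots> \<le> Q\<^sup>2 / L ^ 3" using assms L_pos by (intro divide_right_mono) auto
  finally show ?thesis .
qed

end

section \<open>The Sobolev embedding into continuously differentiable functions\<close>

lemma frechet_eq_sum_pd:
  fixes f :: "real^3 \<Rightarrow> real"
  assumes "f differentiable at x"
  shows "(f has_derivative (\<lambda>h. \<Sum>i\<in>UNIV. pd i f x * h $ i)) (at x)"
proof -
  have d: "(f has_derivative frechet_derivative f (at x)) (at x)"
    using assms by (simp add: frechet_derivative_works)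
  then have lin: "linear (frechet_derivative f (at x))" by (rule has_derivative_linear)
  have "frechet_derivative f (at x) h = (\<Sum>i\<in>UNIV. pd i f x * h $ i)" for h
  proof -
    have "h = (\<Sum>i\<in>UNIV. h $ i *\<^sub>R axis i 1)"
      by (simp add: vec_eq_iff axis_def if_distrib cong: if_cong)
    then have "frechet_derivative f (at x) h = frechet_derivative f (at x) (\<Sum>i\<in>UNIV. h $ i *\<^sub>R axis i 1)"
      by simp
    then show ?thesis by (simp add: linear_sum[OF lin] linear_scale[OF lin] pd_def mult.commute)
  qed
  then show ?thesis using d by presburger
qed

context periodic_box
begin

lemma psum_differentiable: "psum N u differentiable at x"
  and psum_continuous: "continuous_on UNIV (psum N u)"
  and psum_periodic: "periodic L (psum N u)"
  and pd_psum_continuous: "continuous_on UNIV (pd i (psum N u))"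
  unfolding psum_def pd_trig by (rule differentiable_trig continuous_trig periodic_trig)+

text \<open>
  The Sobolev embedding. The Fourier series converges uniformly together with its gradient; its limit has
  the same Fourier coefficients as the function and therefore coincides with it everywhere. The rate of
  convergence depends on the function only through the bound on its energy.
\<close>

lemma fourier_series_C1:
  assumes c: "continuous_on UNIV u" and p: "periodic L u"
    and e: "\<And>N. sobolev_energy N u \<le> Q\<^sup>2" and Q: "Q \<ge> 0"
  shows "u differentiable at x" and "continuous_on UNIV (pd i u)"
    and "\<bar>u x - psum N u x\<bar> \<le> Q * lattice_tail N / L ^ 3"
    and "\<bar>pd i u x - pd i (psum N u) x\<bar> \<le> Q * lattice_tail N / L ^ 3"
    and "\<bar>u x\<bar> \<le> Q * sup_const / L ^ 3"
    and "\<bar>pd i u x\<bar> \<le> Q * sup_const / L ^ 3"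
proof -
  let ?e = "\<lambda>N. Q * lattice_tail N / L ^ 3"
  have e0: "?e \<longlonglongrightarrow> 0"
    using tendsto_mult_right[OF lattice_tail_lim, of "Q / L ^ 3"] by (simp add: mult.commute)
  have lim: "\<exists>l. X \<longlonglongrightarrow> l \<and> (\<forall>N. \<bar>l - X N\<bar> \<le> ?e N)"
    if X: "\<And>N M. N \<le> M \<Longrightarrow> \<bar>X M - X N\<bar> \<le> ?e N" for X :: "nat \<Rightarrow> real"
  proof -
    have "Cauchy X"
    proof (rule metric_CauchyI)
      fix d :: real assume "d > 0"
      then have "\<forall>\<^sub>F N in sequentially. ?e N < d / 2" using order_tendstoD(2)[OF e0, of "d / 2"] by simp
      then obtain N where N: "?e N < d / 2" by (auto simp: eventually_sequentially)
      have "dist (X m) (X n) < d" if "m \<ge> N" "n \<ge> N" for m n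
        using X[OF that(1)] X[OF that(2)] N unfolding dist_real_def by linarith
      then show "\<exists>M. \<forall>m\<ge>M. \<forall>n\<ge>M. dist (X m) (X n) < d" by blast
    qed
    then obtain l where l: "X \<longlonglongrightarrow> l" using Cauchy_convergent convergent_def by blast
    have "\<bar>l - X N\<bar> \<le> ?e N" for N
    proof (rule tendsto_upperbound)
      show "(\<lambda>M. \<bar>X M - X N\<bar>) \<longlonglongrightarrow> \<bar>l - X N\<bar>" by (intro tendsto_intros l)
      show "\<forall>\<^sub>F M in sequentially. \<bar>X M - X N\<bar> \<le> ?e N"
        using X by (intro eventually_sequentiallyI[of N])
    qed auto
    then show ?thesis using l by blast
  qed
  note t = psum_tail[OF _ e Q]
  obtain g where g: "\<And>x. (\<lambda>N. psum N u x) \<longlonglongrightarrow> g x" "\<And>x N. \<bar>g x - psum N u x\<bar> \<le> ?e N"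
    using lim[OF t(1)] by metis
  have "\<exists>l. (\<lambda>N. pd i (psum N u) x) \<longlonglongrightarrow> l \<and> (\<forall>N. \<bar>l - pd i (psum N u) x\<bar> \<le> ?e N)" for i x
    by (rule lim) (rule t(2))
  then obtain g' where g': "\<And>i x. (\<lambda>N. pd i (psum N u) x) \<longlonglongrightarrow> g' i x"
      "\<And>i x N. \<bar>g' i x - pd i (psum N u) x\<bar> \<le> ?e N" by metis
  have unif: "continuous_on UNIV f"
    if "\<And>N. continuous_on UNIV (F N)" "\<And>x N. \<bar>f x - F N x\<bar> \<le> ?e N"
    for f :: "real^3 \<Rightarrow> real" and F
  proof (rule uniform_limit_theorem)
    show "uniform_limit UNIV F f sequentially"
    proof (rule uniform_limitI)
      fix d :: real assume "d > 0"
      then have "\<forall>\<^sub>F N in sequentially. ?e N < d" using order_tendstoD(2)[OF e0] by simp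
      then show "\<forall>\<^sub>F N in sequentially. \<forall>x\<in>UNIV. dist (F N x) (f x) < d"
      proof (eventually_elim, intro ballI)
        fix N x assume "?e N < d"
        then show "dist (F N x) (f x) < d" using that(2)[of x N] unfolding dist_real_def by linarith
      qed
    qed
  qed (use that in auto)
  have gc: "continuous_on UNIV g" using unif[OF psum_continuous g(2)] .
  have gp: "periodic L g"
  proof -
    have "(\<lambda>N. psum N u (x + axis i L)) = (\<lambda>N. psum N u x)" for x i
      using psum_periodic by (simp add: periodic_def)
    then have "g (x + axis i L) = g x" for x i using g(1)[of "x + axis i L"] g(1)[of x] LIMSEQ_unique by metis
    then show ?thesis by (simp add: periodic_def)
  qed
  have coef: "I (\<lambda>x. g x * w x) = l"
    if w: "continuous_on UNIV w" "\<And>x. \<bar>w x\<bar> \<le> 1"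
      and l: "\<And>N. N \<ge> K \<Longrightarrow> I (\<lambda>x. psum N u x * w x) = l" for w :: "real^3 \<Rightarrow> real" and l K
  proof (rule LIMSEQ_unique)
    show "(\<lambda>N. I (\<lambda>x. psum N u x * w x)) \<longlonglongrightarrow> I (\<lambda>x. g x * w x)"
    proof (rule I_tendsto_uniform[OF _ _ _ e0])
      fix N x
      have "\<bar>psum N u x * w x - g x * w x\<bar> = \<bar>g x - psum N u x\<bar> * \<bar>w x\<bar>"
        by (simp add: abs_mult[symmetric] algebra_simps abs_minus_commute)
      also have "\<dots> \<le> ?e N * 1"
        using g(2)[of x N] w(2)[of x] by (intro mult_mono) auto
      finally show "\<bar>psum N u x * w x - g x * w x\<bar> \<le> ?e N" by simp
    qed (intro continuous_intros gc w psum_continuous)+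
    show "(\<lambda>N. I (\<lambda>x. psum N u x * w x)) \<longlonglongrightarrow> l"
      using l by (intro tendsto_eventually eventually_sequentiallyI[of K])
  qed
  have in_cube: "\<exists>K. \<forall>N\<ge>K. k \<in> cube N" for k
  proof (intro exI allI impI)
    fix N assume N: "nat (\<Sum>i\<in>UNIV. \<bar>k $ i\<bar>) \<le> N"
    have "\<bar>k $ i\<bar> \<le> (\<Sum>i\<in>UNIV. \<bar>k $ i\<bar>)" for i by (rule member_le_sum) auto
    then have "\<bar>k $ i\<bar> \<le> int N" for i using N by (meson nat_le_iff order_trans)
    then show "k \<in> cube N" by (simp add: cube_def)
  qed
  have c3: "L ^ 3 * (y / L ^ 3) = y" for y using L_pos by simp
  \<comment> \<open>As soon as the cube contains \<open>k\<close>, the partial sums have the same \<open>k\<close>-th coefficients as \<open>u\<close>.\<close>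
  have gcoef: "ccoef g k = ccoef u k" "scoef g k = scoef u k" for k
  proof -
    obtain K where K: "\<And>N. N \<ge> K \<Longrightarrow> k \<in> cube N" using in_cube by blast
    have "ccoef (psum N u) k = L ^ 3 * (ccoef u k / L ^ 3)" "scoef (psum N u) k = L ^ 3 * (scoef u k / L ^ 3)"
      if "N \<ge> K" for N
      unfolding psum_def
      by (rule ccoef_trig scoef_trig; simp add: finite_cube cube_uminus ccoef_uminus scoef_uminus K[OF that])+
    then have "ccoef (psum N u) k = ccoef u k" "scoef (psum N u) k = scoef u k" if "N \<ge> K" for N
      using that unfolding c3 by blast+
    then show "ccoef g k = ccoef u k" "scoef g k = scoef u k"
      using coef[of "\<lambda>x. cos (wave k \<bullet> x)" K "ccoef u k"] coef[of "\<lambda>x. sin (wave k \<bullet> x)" K "scoef u k"]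
      by (simp_all add: ccoef_def scoef_def cont_cos cont_sin)
  qed
  have "u x - g x = 0" for x
  proof (rule fourier_unique[of "\<lambda>x. u x - g x"])
    show "continuous_on UNIV (\<lambda>x. u x - g x)" by (intro continuous_intros c gc)
    show "periodic L (\<lambda>x. u x - g x)" using p gp by (simp add: periodic_def)
    show "ccoef (\<lambda>x. u x - g x) k = 0" "scoef (\<lambda>x. u x - g x) k = 0" for k
      using gcoef[of k] c gc
      by (simp_all add: ccoef_def scoef_def left_diff_distrib cell_integrable_cont_mult_cos cell_integrable_cont_mult_sin)
  qed
  then have ug: "g = u" by (simp add: fun_eq_iff)
  \<comment> \<open>Uniform convergence of the gradients makes the limit differentiable.\<close>
  have "\<exists>G. \<forall>x\<in>UNIV. (\<lambda>N. psum N u x) \<longlonglongrightarrow> G x \<and>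
      (G has_derivative (\<lambda>h. \<Sum>i\<in>UNIV. g' i x * h $ i)) (at x within UNIV)"
  proof (rule has_derivative_sequence)
    show "(psum N u has_derivative (\<lambda>h. \<Sum>i\<in>UNIV. pd i (psum N u) x * h $ i)) (at x within UNIV)" for N x
      using frechet_eq_sum_pd[OF psum_differentiable] by simp
    show "(\<lambda>N. psum N u 0) \<longlonglongrightarrow> g 0" by (rule g(1))
    fix d :: real assume d: "d > 0"
    then have "\<forall>\<^sub>F N in sequentially. ?e N < d / 3" using order_tendstoD(2)[OF e0, of "d / 3"] by simp
    then show "\<forall>\<^sub>F N in sequentially. \<forall>x\<in>UNIV. \<forall>h.
        norm ((\<Sum>i\<in>UNIV. pd i (psum N u) x * h $ i) - (\<Sum>i\<in>UNIV. g' i x * h $ i)) \<le> d * norm h"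
    proof (eventually_elim, intro ballI allI)
      fix N x and h :: "real^3" assume N: "?e N < d / 3"
      have "norm ((\<Sum>i\<in>UNIV. pd i (psum N u) x * h $ i) - (\<Sum>i\<in>UNIV. g' i x * h $ i))
          = \<bar>\<Sum>i\<in>UNIV. (pd i (psum N u) x - g' i x) * h $ i\<bar>"
        by (simp add: sum_subtractf left_diff_distrib)
      also have "\<dots> \<le> (\<Sum>i\<in>UNIV. \<bar>(pd i (psum N u) x - g' i x) * h $ i\<bar>)" by (rule sum_abs)
      also have "\<dots> \<le> (\<Sum>i\<in>(UNIV::3 set). d / 3 * norm h)"
      proof (rule sum_mono)
        fix i
        have "\<bar>pd i (psum N u) x - g' i x\<bar> \<le> d / 3" using g'(2)[of i x N] N by linarith
        then show "\<bar>(pd i (psum N u) x - g' i x) * h $ i\<bar> \<le> d / 3 * norm h"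
          unfolding abs_mult using component_le_norm_cart[of h i] d by (intro mult_mono) auto
      qed
      finally show "norm ((\<Sum>i\<in>UNIV. pd i (psum N u) x * h $ i) - (\<Sum>i\<in>UNIV. g' i x * h $ i)) \<le> d * norm h"
        by simp
    qed
  qed auto
  then obtain G where G: "\<And>x. (\<lambda>N. psum N u x) \<longlonglongrightarrow> G x"
      "\<And>x. (G has_derivative (\<lambda>h. \<Sum>i\<in>UNIV. g' i x * h $ i)) (at x)" by auto
  have "G = u" using LIMSEQ_unique[OF G(1) g(1)] ug by auto
  then have der: "(u has_derivative (\<lambda>h. \<Sum>i\<in>UNIV. g' i x * h $ i)) (at x)" for x using G(2) by simp
  then have pdu: "pd i u = g' i" for i
    by (auto simp: fun_eq_iff pd_eqI[OF der] axis_def if_distrib cong: if_cong)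
  show "u differentiable at x" using der differentiable_def by blast
  show "continuous_on UNIV (pd i u)" unfolding pdu by (rule unif[OF pd_psum_continuous g'(2)])
  show "\<bar>u x - psum N u x\<bar> \<le> Q * lattice_tail N / L ^ 3" using g(2) ug by simp
  show "\<bar>pd i u x - pd i (psum N u) x\<bar> \<le> Q * lattice_tail N / L ^ 3" unfolding pdu by (rule g'(2))
  show "\<bar>u x\<bar> \<le> Q * sup_const / L ^ 3"
  proof (rule tendsto_upperbound)
    show "(\<lambda>M. \<bar>psum M u x\<bar>) \<longlonglongrightarrow> \<bar>u x\<bar>" using g(1) ug by (intro tendsto_intros) simp
  qed (use psum_bound(1)[OF e Q] in auto)
  show "\<bar>pd i u x\<bar> \<le> Q * sup_const / L ^ 3"
  proof (rule tendsto_upperbound)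
    show "(\<lambda>M. \<bar>pd i (psum M u) x\<bar>) \<longlonglongrightarrow> \<bar>pd i u x\<bar>" unfolding pdu by (intro tendsto_intros g'(1))
  qed (use psum_bound(2)[OF e Q] in auto)
qed

lemma L2_per_diff:
  assumes "L2_per L u" "L2_per L w" shows "L2_per L (\<lambda>x. u x - w x)"
proof -
  have m: "(\<lambda>x. u x - w x) \<in> borel_measurable lebesgue"
    using assms by (auto simp: L2_per_def)
  have "cell_integrable (\<lambda>x. (u x - w x)\<^sup>2)"
  proof (rule Bochner_Integration.integrable_bound)
    show "cell_integrable (\<lambda>x. 2 * (u x)\<^sup>2 + 2 * (w x)\<^sup>2)" using L2_per_integrable[OF assms(1)] L2_per_integrable[OF assms(2)] by simp
    show "(\<lambda>x. (u x - w x)\<^sup>2) \<in> borel_measurable (lebesgue_on (cell L))"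
      by (intro borel_measurable_power measurable_restrict_space1 m)
    have "(a - b)\<^sup>2 \<le> 2 * a\<^sup>2 + 2 * b\<^sup>2" for a b :: real
      using zero_le_power2[of "a + b"] by (simp add: power2_eq_square algebra_simps)
    then show "AE x in lebesgue_on (cell L). norm ((u x - w x)\<^sup>2) \<le> norm (2 * (u x)\<^sup>2 + 2 * (w x)\<^sup>2)"
      by simp
  qed
  then show ?thesis using assms m by (auto simp: L2_per_def periodic_def cell_integrable_iff_set_integrable)
qed

lemma test_function_continuous: "test_function L \<phi> \<Longrightarrow> continuous_on UNIV (iter_pd js \<phi>)"
  by (rule differentiable_continuous_UNIV) (simp add: test_function_def)

lemma weak_derivative_diff:
  assumes u: "cell_integrable u" "cell_integrable u'" and w: "weak_derivative L js u w" "weak_derivative L js u' w'"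
  shows "weak_derivative L js (\<lambda>x. u x - u' x) (\<lambda>x. w x - w' x)"
  unfolding weak_derivative_def
proof (intro conjI allI impI)
  have L2: "L2_per L w" "L2_per L w'" using w by (auto simp: weak_derivative_def)
  then show "L2_per L (\<lambda>x. w x - w' x)" by (rule L2_per_diff)
  fix \<phi> assume \<phi>: "test_function L \<phi>"
  note c = test_function_continuous[OF \<phi>, of js] test_function_continuous[OF \<phi>, of "[]", simplified]
  show "(LINT x:cell L|lebesgue. (u x - u' x) * iter_pd js \<phi> x)
      = (- 1) ^ length js * (LINT x:cell L|lebesgue. (w x - w' x) * \<phi> x)"
    using w \<phi> u c L2_per_integrable(1)[OF L2(1)] L2_per_integrable(1)[OF L2(2)]
    unfolding weak_derivative_def I_eq_set_integral
    by (simp add: left_diff_distrib right_diff_distrib cell_integrable_mult_continuous)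
qed

lemma weak_derivative_wd:
  "\<exists>w. weak_derivative L js u w \<Longrightarrow> weak_derivative L js u (wd L js u)"
  unfolding wd_def by (erule someI_ex)

text \<open>
  Bessel's inequality for the weak derivatives of orders zero and three in a single direction, which are
  among the terms of the Sobolev norm.
\<close>

lemma sobolev_energy_le_norm:
  assumes w: "\<And>j js. length js \<le> m \<Longrightarrow> \<exists>w. weak_derivative L js (\<lambda>y. u y $ j) w" and m: "3 \<le> m"
  shows "sobolev_energy N (\<lambda>y. u y $ j) \<le> L ^ 3 * (sobolev_norm L m u)\<^sup>2"
proof -
  let ?u = "\<lambda>y. u y $ j"
  let ?n = "\<lambda>js j. LINT x:cell L|lebesgue. (wd L js (\<lambda>y. u y $ j) x)\<^sup>2"
  have wdw: "weak_derivative L js (\<lambda>y. u y $ j) (wd L js (\<lambda>y. u y $ j))" if "length js \<le> m" for js j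
    using w[OF that] by (rule weak_derivative_wd)
  have nn: "0 \<le> ?n js j" for js j
    unfolding I_eq_set_integral by (rule integral_nonneg_AE) simp
  have fin: "finite {js :: 3 list. length js \<le> m}" using finite_lists_length_le[of "UNIV :: 3 set" m] by simp
  have B: "(\<Sum>k\<in>cube N. (ccoef (wd L js ?u) k)\<^sup>2 + (scoef (wd L js ?u) k)\<^sup>2) \<le> L ^ 3 * ?n js j"
    if "length js \<le> m" for js
    unfolding I_eq_set_integral by (rule Bessel) (use wdw[OF that] in \<open>simp add: weak_derivative_def\<close>)
  have "sobolev_energy N ?u = (\<Sum>k\<in>cube N. (amplitude ?u k)\<^sup>2 + (\<Sum>i\<in>UNIV. (wave k $ i) ^ 6 * (amplitude ?u k)\<^sup>2))"
    unfolding sobolev_energy_def sobolev_weight_def by (simp add: distrib_right sum_distrib_right)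
  also have "\<dots> = (\<Sum>k\<in>cube N. (ccoef (wd L [] ?u) k)\<^sup>2 + (scoef (wd L [] ?u) k)\<^sup>2)
      + (\<Sum>i\<in>UNIV. \<Sum>k\<in>cube N. (ccoef (wd L [i,i,i] ?u) k)\<^sup>2 + (scoef (wd L [i,i,i] ?u) k)\<^sup>2)"
  proof -
    have 0: "(ccoef (wd L [] ?u) k)\<^sup>2 + (scoef (wd L [] ?u) k)\<^sup>2 = (amplitude ?u k)\<^sup>2" for k
      using coef_weak_0[OF wdw[of "[]" j]] by (simp add: amplitude_sq)
    have 3: "(ccoef (wd L [i,i,i] ?u) k)\<^sup>2 + (scoef (wd L [i,i,i] ?u) k)\<^sup>2 = (wave k $ i) ^ 6 * (amplitude ?u k)\<^sup>2" for k i
      using coef_weak_3[OF wdw[of "[i,i,i]" j]] m by (simp add: amplitude_sq)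
    show ?thesis unfolding 0 3 by (subst sum.swap) (rule sum.distrib)
  qed
  also have "\<dots> \<le> L ^ 3 * ?n [] j + (\<Sum>i\<in>UNIV. L ^ 3 * ?n [i,i,i] j)"
    using m by (intro add_mono sum_mono B) auto
  also have "\<dots> = L ^ 3 * (\<Sum>js\<in>insert [] (range (\<lambda>i. [i,i,i])). ?n js j)"
    by (subst sum.insert) (auto simp: sum.reindex inj_on_def distrib_left sum_distrib_left)
  also have "\<dots> \<le> L ^ 3 * (\<Sum>js | length js \<le> m. ?n js j)"
    using L_pos m by (intro mult_left_mono sum_mono2 fin nn) auto
  also have "\<dots> \<le> L ^ 3 * (\<Sum>j\<in>UNIV. \<Sum>js | length js \<le> m. ?n js j)"
  proof -
    have "(\<Sum>js | length js \<le> m. ?n js j) \<le> (\<Sum>j\<in>UNIV. \<Sum>js | length js \<le> m. ?n js j)"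
      by (rule member_le_sum) (auto intro: sum_nonneg nn)
    then show ?thesis using L_pos by (intro mult_left_mono) auto
  qed
  also have "\<dots> = L ^ 3 * (sobolev_norm L m u)\<^sup>2"
    unfolding sobolev_norm_def by (simp add: sum_nonneg nn)
  finally show ?thesis .
qed

text \<open>
  This bounds the energy at a nearby time by the energy at a fixed time and the distance in the Sobolev
  norm, from \<open>a\<^sup>2 \<le> 2 b\<^sup>2 + 2 (a - b)\<^sup>2\<close>.
\<close>

lemma sobolev_energy_diff:
  assumes "cell_integrable u" "cell_integrable w"
  shows "sobolev_energy N u \<le> 2 * sobolev_energy N w + 2 * sobolev_energy N (\<lambda>x. u x - w x)"
proof -
  have c: "ccoef (\<lambda>x. u x - w x) k = ccoef u k - ccoef w k" "scoef (\<lambda>x. u x - w x) k = scoef u k - scoef w k" for k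
    using assms by (simp_all add: ccoef_def scoef_def left_diff_distrib cell_integrable_cos cell_integrable_sin)
  have sq: "a\<^sup>2 \<le> 2 * b\<^sup>2 + 2 * (a - b)\<^sup>2" for a b :: real
    using zero_le_power2[of "a - 2 * b"] by (simp add: power2_eq_square algebra_simps)
  have "(amplitude u k)\<^sup>2 \<le> 2 * (amplitude w k)\<^sup>2 + 2 * (amplitude (\<lambda>x. u x - w x) k)\<^sup>2" for k
    unfolding amplitude_sq c by (rule order_trans[OF add_mono[OF sq[of _ "ccoef w k"] sq[of _ "scoef w k"]]])
      (simp add: distrib_left)
  then have "sobolev_weight k * (amplitude u k)\<^sup>2
      \<le> sobolev_weight k * (2 * (amplitude w k)\<^sup>2 + 2 * (amplitude (\<lambda>x. u x - w x) k)\<^sup>2)" for k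
    using sobolev_weight_ge(1)[of k] by (intro mult_left_mono) auto
  then show ?thesis
    unfolding sobolev_energy_def sum_distrib_left sum.distrib[symmetric]
    by (intro sum_mono) (simp add: algebra_simps)
qed

end

section \<open>Integral identities for divergence-free fields\<close>

context periodic_box
begin

definition C1_periodic :: "(real^3 \<Rightarrow> real) \<Rightarrow> bool" where
  "C1_periodic f \<longleftrightarrow> (\<forall>x. f differentiable at x) \<and> (\<forall>i. continuous_on UNIV (pd i f)) \<and> periodic L f"

lemma C1_continuous: "C1_periodic f \<Longrightarrow> continuous_on UNIV f"
  unfolding C1_periodic_def by (blast intro: differentiable_continuous_UNIV)

lemma C1_pd_continuous: "C1_periodic f \<Longrightarrow> continuous_on UNIV (pd i f)"
  unfolding C1_periodic_def by blast

lemma C1_trig: "C1_periodic (trig K a b)"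
  by (simp add: C1_periodic_def differentiable_trig pd_trig continuous_trig periodic_trig)

lemma pd_mult:
  assumes "C1_periodic f" "C1_periodic g"
  shows "pd i (\<lambda>x. f x * g x) x = f x * pd i g x + pd i f x * g x"
proof -
  have d: "f differentiable at x" "g differentiable at x" using assms by (auto simp: C1_periodic_def)
  have "((\<lambda>x. f x * g x) has_derivative
      (\<lambda>h. f x * (\<Sum>i\<in>UNIV. pd i g x * h $ i) + (\<Sum>i\<in>UNIV. pd i f x * h $ i) * g x)) (at x)"
    by (rule has_derivative_mult) (use d in \<open>simp_all add: frechet_eq_sum_pd\<close>)
  from pd_eqI[OF this, of i] show ?thesis by (simp add: axis_def if_distrib cong: if_cong)
qed

lemma C1_mult:
  assumes f: "C1_periodic f" and g: "C1_periodic g" shows "C1_periodic (\<lambda>x. f x * g x)"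
proof -
  have "pd i (\<lambda>x. f x * g x) = (\<lambda>x. f x * pd i g x + pd i f x * g x)" for i
    using pd_mult[OF f g] by (simp add: fun_eq_iff)
  moreover have "(\<lambda>x. f x * g x) differentiable at x" for x
    using f g by (intro differentiable_mult) (auto simp: C1_periodic_def)
  ultimately show ?thesis
    using f g by (auto simp: C1_periodic_def periodic_def C1_continuous[OF f] C1_continuous[OF g] intro!: continuous_intros)
qed

lemma integration_by_parts:
  assumes f: "C1_periodic f" and g: "C1_periodic g"
  shows "I (\<lambda>x. pd i f x * g x) = - I (\<lambda>x. f x * pd i g x)"
proof -
  have c: "continuous_on UNIV (\<lambda>x. f x * pd i g x)" "continuous_on UNIV (\<lambda>x. pd i f x * g x)"
    by (intro continuous_intros C1_continuous C1_pd_continuous f g)+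
  have fg: "C1_periodic (\<lambda>x. f x * g x)" using f g by (rule C1_mult)
  have "I (pd i (\<lambda>x. f x * g x)) = 0"
    using fg by (intro I_pd_eq_0) (auto simp: C1_periodic_def)
  also have "pd i (\<lambda>x. f x * g x) = (\<lambda>x. f x * pd i g x + pd i f x * g x)"
    using pd_mult[OF f g] by (simp add: fun_eq_iff)
  finally show ?thesis using c by (simp add: cell_integrable_continuous)
qed

lemma I_sum_continuous:
  "(\<And>j. j \<in> J \<Longrightarrow> continuous_on UNIV (f j)) \<Longrightarrow> I (\<lambda>x. \<Sum>j\<in>J. f j x) = (\<Sum>j\<in>J. I (f j))"
  by (rule Bochner_Integration.integral_sum) (rule cell_integrable_continuous)

text \<open>
  Integration by parts moves the derivative onto the field, where it becomes the divergence.
\<close>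

lemma gradient_orthogonal:
  assumes f: "C1_periodic f" and V: "\<And>i::3. C1_periodic (V i)" and div: "\<And>x. (\<Sum>i\<in>UNIV. pd i (V i) x) = 0"
  shows "(\<Sum>i\<in>UNIV. I (\<lambda>x. V i x * pd i f x)) = 0"
proof -
  have "(\<Sum>i\<in>UNIV. I (\<lambda>x. V i x * pd i f x)) = (\<Sum>i\<in>UNIV. - I (\<lambda>x. pd i (V i) x * f x))"
    by (simp add: integration_by_parts[OF V f])
  also have "\<dots> = - I (\<lambda>x. \<Sum>i\<in>UNIV. pd i (V i) x * f x)"
    unfolding sum_negf
    by (intro arg_cong[where f=uminus] I_sum_continuous[symmetric] continuous_on_mult C1_continuous C1_pd_continuous f V)
  also have "(\<lambda>x. \<Sum>i\<in>UNIV. pd i (V i) x * f x) = (\<lambda>x. 0)"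
    by (simp add: div sum_distrib_right[symmetric])
  finally show ?thesis by simp
qed

lemma pd_trig_commute: "pd i (pd j (trig K a b)) = pd j (pd i (trig K a b))"
  unfolding pd_trig by (simp add: mult.left_commute)

lemma pd_sum_eq_0:
  assumes "\<And>i::3. C1_periodic (f i)" "\<And>x. (\<Sum>i\<in>UNIV. f i x) = 0"
  shows "(\<Sum>i\<in>UNIV. pd k (f i) x) = 0"
proof -
  have "((\<lambda>x. \<Sum>i\<in>UNIV. f i x) has_derivative (\<lambda>h. \<Sum>i\<in>UNIV. \<Sum>j\<in>UNIV. pd j (f i) x * h $ j)) (at x)"
    using assms(1) by (intro has_derivative_sum frechet_eq_sum_pd) (auto simp: C1_periodic_def)
  then have "((\<lambda>x. 0) has_derivative (\<lambda>h. \<Sum>i\<in>UNIV. \<Sum>j\<in>UNIV. pd j (f i) x * h $ j)) (at x)"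
    by (simp add: assms(2))
  from pd_eqI[OF this, of k] have "pd k (\<lambda>x. 0) x = (\<Sum>i\<in>UNIV. pd k (f i) x)"
    by (simp add: axis_def if_distrib cong: if_cong)
  moreover have "pd k (\<lambda>x. 0) x = 0" by (simp add: pd_def)
  ultimately show ?thesis by simp
qed

text \<open>
  The first identity is the energy balance of the advection term; after integrating by parts, the part in
  which the gradient is transported along the field is a derivative of a square along the field and
  integrates to zero. In the other two, moving one derivative produces derivatives of the divergence and,
  for the trace of the cube, again a derivative of a product along the field.
\<close>

lemma trig_field_identities:
  fixes V :: "3 \<Rightarrow> real^3 \<Rightarrow> real"
  assumes V: "\<And>j. \<exists>a b. V j = trig K a b" and div: "\<And>x. (\<Sum>i\<in>UNIV. pd i (V i) x) = 0"
  shows "(\<Sum>i\<in>UNIV. \<Sum>j\<in>UNIV. \<Sum>k\<in>UNIV. I (\<lambda>x. V i x * pd i (V j) x * pd k (pd k (V j)) x))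
      = - (\<Sum>i\<in>UNIV. \<Sum>j\<in>UNIV. \<Sum>k\<in>UNIV. I (\<lambda>x. pd k (V i) x * pd i (V j) x * pd k (V j) x))"
    and "(\<Sum>i\<in>UNIV. \<Sum>j\<in>UNIV. \<Sum>k\<in>UNIV. I (\<lambda>x. pd i (V j) x * pd j (V k) x * pd k (V i) x)) = 0"
    and "(\<Sum>i\<in>UNIV. \<Sum>j\<in>UNIV. I (\<lambda>x. pd i (V j) x * pd j (V i) x)) = 0"
proof -
  define D where "D i j = pd i (V j)" for i j
  have DC: "C1_periodic (V j)" "C1_periodic (D i j)" for i j
    using V[of j] by (auto simp: D_def pd_trig C1_trig)
  have comm: "pd k (D i j) = pd i (D k j)" for i j k
    using V[of j] by (auto simp: D_def pd_trig_commute[of k i])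
  have D0: "(\<Sum>i\<in>UNIV. D i i x) = 0" for x using div by (simp add: D_def)
  have dD0: "(\<Sum>i\<in>UNIV. pd k (D i i) x) = 0" for k x by (rule pd_sum_eq_0) (auto simp: DC D0)
  note cont = C1_continuous[OF DC(1)] C1_continuous[OF DC(2)] C1_pd_continuous[OF DC(2)]
  have transport: "(\<Sum>i\<in>UNIV. I (\<lambda>x. V i x * pd i f x)) = 0" if "C1_periodic f" for f
    using that DC(1) div by (rule gradient_orthogonal)
  \<comment> \<open>Half the derivative of \<open>(D k j)\<^sup>2\<close> along the field.\<close>
  have half: "(\<Sum>i\<in>UNIV. I (\<lambda>x. V i x * (D k j x * pd i (D k j) x))) = 0" for k j
  proof -
    have "(\<Sum>i\<in>UNIV. I (\<lambda>x. V i x * pd i (\<lambda>x. D k j x * D k j x) x)) = 0"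
      by (rule transport) (intro C1_mult DC)
    moreover have "I (\<lambda>x. V i x * pd i (\<lambda>x. D k j x * D k j x) x) = 2 * I (\<lambda>x. V i x * (D k j x * pd i (D k j) x))" for i
    proof -
      have "(\<lambda>x. V i x * pd i (\<lambda>x. D k j x * D k j x) x) = (\<lambda>x. 2 * (V i x * (D k j x * pd i (D k j) x)))"
        by (simp add: pd_mult DC fun_eq_iff)
      then show ?thesis by simp
    qed
    ultimately show ?thesis by (simp add: sum_distrib_left[symmetric])
  qed
  have one: "I (\<lambda>x. V i x * D i j x * pd k (D k j) x)
      = - I (\<lambda>x. D k i x * D i j x * D k j x) - I (\<lambda>x. V i x * (D k j x * pd i (D k j) x))" for i j k
  proof -
    have "I (\<lambda>x. V i x * D i j x * pd k (D k j) x) = I (\<lambda>x. pd k (D k j) x * (V i x * D i j x))"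
      by (simp add: mult.commute)
    also have "\<dots> = - I (\<lambda>x. D k j x * pd k (\<lambda>x. V i x * D i j x) x)"
      by (rule integration_by_parts) (intro C1_mult DC)+
    also have "(\<lambda>x. D k j x * pd k (\<lambda>x. V i x * D i j x) x)
        = (\<lambda>x. V i x * (D k j x * pd i (D k j) x) + D k i x * D i j x * D k j x)"
      unfolding pd_mult[OF DC(1) DC(2)] comm[of k i j] by (simp add: D_def[of k i] fun_eq_iff algebra_simps)
    also have "I \<dots> = I (\<lambda>x. V i x * (D k j x * pd i (D k j) x)) + I (\<lambda>x. D k i x * D i j x * D k j x)"
      by (intro Bochner_Integration.integral_add cell_integrable_continuous continuous_intros cont)
    finally show ?thesis by simp
  qed
  have "(\<Sum>i\<in>UNIV. \<Sum>j\<in>UNIV. \<Sum>k\<in>UNIV. I (\<lambda>x. V i x * (D k j x * pd i (D k j) x)))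
      = (\<Sum>j\<in>UNIV. \<Sum>k\<in>UNIV. \<Sum>i\<in>UNIV. I (\<lambda>x. V i x * (D k j x * pd i (D k j) x)))"
    by (subst sum.swap) (intro sum.cong refl sum.swap)
  also have "\<dots> = 0" by (simp add: half)
  finally show "(\<Sum>i\<in>UNIV. \<Sum>j\<in>UNIV. \<Sum>k\<in>UNIV. I (\<lambda>x. V i x * pd i (V j) x * pd k (pd k (V j)) x))
      = - (\<Sum>i\<in>UNIV. \<Sum>j\<in>UNIV. \<Sum>k\<in>UNIV. I (\<lambda>x. pd k (V i) x * pd i (V j) x * pd k (V j) x))"
    unfolding D_def[symmetric] one by (simp add: sum_subtractf sum_negf)
  show "(\<Sum>i\<in>UNIV. \<Sum>j\<in>UNIV. I (\<lambda>x. pd i (V j) x * pd j (V i) x)) = 0"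
  proof -
    have "I (\<lambda>x. pd i (V j) x * D j i x) = - I (\<lambda>x. V j x * pd j (D i i) x)" for i j
      unfolding comm[of j i i] by (rule integration_by_parts) (rule DC)+
    then have "(\<Sum>i\<in>UNIV. \<Sum>j\<in>UNIV. I (\<lambda>x. pd i (V j) x * D j i x)) = - (\<Sum>i\<in>UNIV. \<Sum>j\<in>UNIV. I (\<lambda>x. V j x * pd j (D i i) x))"
      by (simp add: sum_negf)
    also have "(\<Sum>i\<in>UNIV. \<Sum>j\<in>UNIV. I (\<lambda>x. V j x * pd j (D i i) x)) = 0"
      by (simp add: transport DC)
    finally show ?thesis by (simp add: D_def)
  qed
  \<comment> \<open>Exchanging \<open>i\<close> and \<open>k\<close> shows that twice this sum is the integral of a derivative along the field.\<close>
  define R where "R = (\<Sum>i\<in>UNIV. \<Sum>k\<in>UNIV. \<Sum>j\<in>UNIV. I (\<lambda>x. V j x * (pd j (D i k) x * D k i x)))"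
  have R0: "R = 0"
  proof -
    have "R + R = (\<Sum>i\<in>UNIV. \<Sum>k\<in>UNIV. \<Sum>j\<in>UNIV. I (\<lambda>x. V j x * (pd j (D i k) x * D k i x)))
        + (\<Sum>i\<in>UNIV. \<Sum>k\<in>UNIV. \<Sum>j\<in>UNIV. I (\<lambda>x. V j x * (pd j (D k i) x * D i k x)))"
      unfolding R_def by (rule arg_cong2[where f="(+)", OF refl]) (rule sum.swap)
    also have "\<dots> = (\<Sum>i\<in>UNIV. \<Sum>k\<in>UNIV. \<Sum>j\<in>UNIV. I (\<lambda>x. V j x * pd j (\<lambda>x. D i k x * D k i x) x))"
      unfolding sum.distrib[symmetric]
    proof (intro sum.cong refl)
      fix i k j
      have "I (\<lambda>x. V j x * pd j (\<lambda>x. D i k x * D k i x) x)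
          = I (\<lambda>x. V j x * (pd j (D i k) x * D k i x) + V j x * (pd j (D k i) x * D i k x))"
        by (simp add: pd_mult DC algebra_simps)
      also have "\<dots> = I (\<lambda>x. V j x * (pd j (D i k) x * D k i x)) + I (\<lambda>x. V j x * (pd j (D k i) x * D i k x))"
        by (intro Bochner_Integration.integral_add cell_integrable_continuous continuous_intros cont)
      finally show "I (\<lambda>x. V j x * (pd j (D i k) x * D k i x)) + I (\<lambda>x. V j x * (pd j (D k i) x * D i k x))
          = I (\<lambda>x. V j x * pd j (\<lambda>x. D i k x * D k i x) x)" ..
    qed
    also have "\<dots> = 0" by (simp add: transport C1_mult DC)
    finally show ?thesis by simp
  qed
  have two: "I (\<lambda>x. pd i (V j) x * D j k x * D k i x)
      = - I (\<lambda>x. V j x * (pd j (D i k) x * D k i x)) - I (\<lambda>x. V j x * D j k x * pd k (D i i) x)" for i j k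
  proof -
    have "I (\<lambda>x. pd i (V j) x * D j k x * D k i x) = I (\<lambda>x. pd i (V j) x * (D j k x * D k i x))"
      by (simp add: mult.assoc)
    also have "\<dots> = - I (\<lambda>x. V j x * pd i (\<lambda>x. D j k x * D k i x) x)"
      by (rule integration_by_parts) (intro C1_mult DC)+
    also have "(\<lambda>x. V j x * pd i (\<lambda>x. D j k x * D k i x) x)
        = (\<lambda>x. V j x * (pd j (D i k) x * D k i x) + V j x * D j k x * pd k (D i i) x)"
      unfolding pd_mult[OF DC(2) DC(2)] comm[of i j k] comm[of i k i] by (simp add: fun_eq_iff algebra_simps)
    also have "I \<dots> = I (\<lambda>x. V j x * (pd j (D i k) x * D k i x)) + I (\<lambda>x. V j x * D j k x * pd k (D i i) x)"
      by (intro Bochner_Integration.integral_add cell_integrable_continuous continuous_intros cont)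
    finally show ?thesis by simp
  qed
  have "(\<Sum>i\<in>UNIV. \<Sum>j\<in>UNIV. \<Sum>k\<in>UNIV. I (\<lambda>x. V j x * D j k x * pd k (D i i) x))
      = (\<Sum>j\<in>UNIV. \<Sum>k\<in>UNIV. \<Sum>i\<in>UNIV. I (\<lambda>x. V j x * D j k x * pd k (D i i) x))"
    by (subst sum.swap) (intro sum.cong refl sum.swap)
  also have "\<dots> = (\<Sum>j\<in>UNIV. \<Sum>k\<in>UNIV. I (\<lambda>x. \<Sum>i\<in>UNIV. V j x * D j k x * pd k (D i i) x))"
    by (intro sum.cong refl I_sum_continuous[symmetric] continuous_intros cont)
  also have "\<dots> = 0" by (simp add: sum_distrib_left[symmetric] dD0)
  finally have Z: "(\<Sum>i\<in>UNIV. \<Sum>j\<in>UNIV. \<Sum>k\<in>UNIV. I (\<lambda>x. V j x * D j k x * pd k (D i i) x)) = 0" .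
  have R': "(\<Sum>i\<in>UNIV. \<Sum>j\<in>UNIV. \<Sum>k\<in>UNIV. I (\<lambda>x. V j x * (pd j (D i k) x * D k i x))) = R"
    unfolding R_def by (intro sum.cong refl sum.swap)
  have "(\<Sum>i\<in>UNIV. \<Sum>j\<in>UNIV. \<Sum>k\<in>UNIV. I (\<lambda>x. pd i (V j) x * D j k x * D k i x)) = 0"
    unfolding two sum_subtractf sum_negf Z R' R0 by simp
  then show "(\<Sum>i\<in>UNIV. \<Sum>j\<in>UNIV. \<Sum>k\<in>UNIV. I (\<lambda>x. pd i (V j) x * pd j (V k) x * pd k (V i) x)) = 0"
    by (simp add: D_def)
qed

end

section \<open>Passing to the limit at a fixed time\<close>

lemma triple_product_diff_le:
  fixes a b c a' b' c' :: real
  assumes "\<bar>a\<bar> \<le> B" "\<bar>b\<bar> \<le> B" "\<bar>c'\<bar> \<le> B" "\<bar>a'\<bar> \<le> B" "\<bar>b'\<bar> \<le> B"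
    and "\<bar>a - a'\<bar> \<le> e" "\<bar>b - b'\<bar> \<le> e" "\<bar>c - c'\<bar> \<le> e"
  shows "\<bar>a * b * c - a' * b' * c'\<bar> \<le> 3 * B\<^sup>2 * e"
proof -
  have B: "0 \<le> B" and e: "0 \<le> e" using assms by linarith+
  have "a * b * c - a' * b' * c' = a * b * (c - c') + a * (b - b') * c' + (a - a') * b' * c'"
    by (simp add: algebra_simps)
  also have "\<bar>\<dots>\<bar> \<le> \<bar>a * b * (c - c')\<bar> + \<bar>a * (b - b') * c'\<bar> + \<bar>(a - a') * b' * c'\<bar>"
    by (intro order_trans[OF abs_triangle_ineq] add_mono abs_triangle_ineq order_refl)
  also have "\<dots> \<le> B * B * e + B * e * B + e * B * B"
    unfolding abs_mult by (intro add_mono mult_mono assms mult_nonneg_nonneg abs_ge_zero B e)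
  finally show ?thesis by (simp add: power2_eq_square algebra_simps)
qed

lemma double_product_diff_le:
  fixes a b a' b' :: real
  assumes "\<bar>a\<bar> \<le> B" "\<bar>b'\<bar> \<le> B" "\<bar>a - a'\<bar> \<le> e" "\<bar>b - b'\<bar> \<le> e"
  shows "\<bar>a * b - a' * b'\<bar> \<le> 2 * B * e"
proof -
  have B: "0 \<le> B" and e: "0 \<le> e" using assms by linarith+
  have "a * b - a' * b' = a * (b - b') + (a - a') * b'" by (simp add: algebra_simps)
  also have "\<bar>\<dots>\<bar> \<le> \<bar>a * (b - b')\<bar> + \<bar>(a - a') * b'\<bar>" by (rule abs_triangle_ineq)
  also have "\<dots> \<le> B * e + e * B"
    unfolding abs_mult by (intro add_mono mult_mono assms mult_nonneg_nonneg abs_ge_zero B e)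
  finally show ?thesis by (simp add: algebra_simps)
qed

context periodic_box
begin

text \<open>
  The last condition is the vanishing of the divergence, expressed by Fourier coefficients so that the
  partial sums inherit it.
\<close>

definition finite_energy_field :: "real \<Rightarrow> (3 \<Rightarrow> real^3 \<Rightarrow> real) \<Rightarrow> bool" where
  "finite_energy_field Q u \<longleftrightarrow> 0 \<le> Q \<and>
     (\<forall>j. continuous_on UNIV (u j) \<and> periodic L (u j) \<and> (\<forall>N. sobolev_energy N (u j) \<le> Q\<^sup>2)) \<and>
     (\<forall>k. (\<Sum>i\<in>UNIV. wave k $ i * ccoef (u i) k) = 0 \<and> (\<Sum>i\<in>UNIV. wave k $ i * scoef (u i) k) = 0)"

context
  fixes Q :: real and u :: "3 \<Rightarrow> real^3 \<Rightarrow> real"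
  assumes field: "finite_energy_field Q u"
begin

lemma Q_nonneg: "0 \<le> Q" and u_cont: "continuous_on UNIV (u j)" and u_per: "periodic L (u j)"
  and u_energy: "sobolev_energy N (u j) \<le> Q\<^sup>2"
  using field by (auto simp: finite_energy_field_def)

lemmas u_series = fourier_series_C1[OF u_cont u_per u_energy Q_nonneg]
lemmas u_psum = psum_bound[OF u_energy Q_nonneg]

lemma u_C1: "C1_periodic (u j)"
  using u_series(1,2) u_per by (auto simp: C1_periodic_def)

lemma psum_C1: "C1_periodic (psum N (u j))"
  unfolding psum_def by (rule C1_trig)

lemma pd_psum_C1: "C1_periodic (pd i (psum N (u j)))"
  unfolding psum_def pd_trig by (rule C1_trig)

lemma psum_div: "(\<Sum>i\<in>UNIV. pd i (psum N (u i)) x) = 0"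
proof -
  have "(\<Sum>i\<in>UNIV. pd i (psum N (u i)) x) =
      (\<Sum>k\<in>cube N. (\<Sum>i\<in>UNIV. wave k $ i * scoef (u i) k) / L ^ 3 * cos (wave k \<bullet> x)
                 - (\<Sum>i\<in>UNIV. wave k $ i * ccoef (u i) k) / L ^ 3 * sin (wave k \<bullet> x))"
    unfolding psum_def pd_trig trig_def
    by (subst sum.swap) (simp add: sum.distrib sum_subtractf sum_divide_distrib sum_distrib_right)
  also have "\<dots> = 0" using field by (simp add: finite_energy_field_def)
  finally show ?thesis .
qed

lemmas psum_identities = trig_field_identities[where V="\<lambda>j. psum N (u j)" and K="cube N" for N, OF _ psum_div]

lemma psum_trig: "\<exists>a b. psum N (u j) = trig (cube N) a b"
  unfolding psum_def by blast

definition "sup_bound = Q * sup_const / L ^ 3"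
definition "fourier_error N = Q * lattice_tail N / L ^ 3"

lemma fourier_error_lim: "fourier_error \<longlonglongrightarrow> 0"
  unfolding fourier_error_def[abs_def] using tendsto_mult_right[OF lattice_tail_lim, of "Q / L ^ 3"] by (simp add: mult.commute)

lemma sup_bound_nonneg: "0 \<le> sup_bound"
  using order_trans[OF abs_ge_zero u_series(5)] by (simp add: sup_bound_def)

lemma fourier_error_nonneg: "0 \<le> fourier_error N"
  using Q_nonneg lattice_tail_nonneg L_pos by (simp add: fourier_error_def)

lemmas field_bounds = u_series(3-6)[folded fourier_error_def sup_bound_def] u_psum[folded sup_bound_def]

lemmas field_continuity = C1_continuous[OF u_C1] C1_continuous[OF psum_C1] C1_continuous[OF pd_psum_C1] C1_pd_continuous[OF u_C1]
  C1_pd_continuous[OF psum_C1] C1_pd_continuous[OF pd_psum_C1]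

lemma I_diff_le:
  assumes "continuous_on UNIV f" "continuous_on UNIV g" "\<And>x. \<bar>f x - g x\<bar> \<le> c"
  shows "\<bar>I f - I g\<bar> \<le> c * L ^ 3"
proof -
  have "I f - I g = I (\<lambda>x. f x - g x)"
    by (rule Bochner_Integration.integral_diff[symmetric]) (auto intro: cell_integrable_continuous assms)
  then show ?thesis using I_abs_le[of "\<lambda>x. f x - g x" c] assms
    by (auto intro!: cell_integrable_continuous continuous_intros)
qed

lemma triple_conv:
  "\<bar>I (\<lambda>x. pd a (psum N (u b)) x * pd c (psum N (u d)) x * pd e (psum N (u f)) x)
     - I (\<lambda>x. pd a (u b) x * pd c (u d) x * pd e (u f) x)\<bar> \<le> 3 * sup_bound\<^sup>2 * fourier_error N * L ^ 3"
proof (rule I_diff_le)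
  fix x
  show "\<bar>pd a (psum N (u b)) x * pd c (psum N (u d)) x * pd e (psum N (u f)) x
     - pd a (u b) x * pd c (u d) x * pd e (u f) x\<bar> \<le> 3 * sup_bound\<^sup>2 * fourier_error N"
    by (rule triple_product_diff_le) (use field_bounds in \<open>auto simp: abs_minus_commute\<close>)
qed (intro continuous_intros field_continuity)+

lemma double_conv:
  "\<bar>I (\<lambda>x. pd a (psum N (u b)) x * pd c (psum N (u d)) x)
     - I (\<lambda>x. pd a (u b) x * pd c (u d) x)\<bar> \<le> 2 * sup_bound * fourier_error N * L ^ 3"
proof (rule I_diff_le)
  fix x
  show "\<bar>pd a (psum N (u b)) x * pd c (psum N (u d)) x - pd a (u b) x * pd c (u d) x\<bar> \<le> 2 * sup_bound * fourier_error N"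
    by (rule double_product_diff_le) (use field_bounds in \<open>auto simp: abs_minus_commute\<close>)
qed (intro continuous_intros field_continuity)+

lemma triple_lim:
  "(\<lambda>N. I (\<lambda>x. pd a (psum N (u b)) x * pd c (psum N (u d)) x * pd e (psum N (u f)) x))
    \<longlonglongrightarrow> I (\<lambda>x. pd a (u b) x * pd c (u d) x * pd e (u f) x)"
proof (rule Lim_null_comparison[THEN Lim_null[THEN iffD2]])
  show "(\<lambda>N. 3 * sup_bound\<^sup>2 * fourier_error N * L ^ 3) \<longlonglongrightarrow> 0"
    by (rule tendsto_eq_intros fourier_error_lim refl | simp)+
qed (use triple_conv in auto)

lemma double_lim:
  "(\<lambda>N. I (\<lambda>x. pd a (psum N (u b)) x * pd c (psum N (u d)) x))
    \<longlonglongrightarrow> I (\<lambda>x. pd a (u b) x * pd c (u d) x)"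
proof (rule Lim_null_comparison[THEN Lim_null[THEN iffD2]])
  show "(\<lambda>N. 2 * sup_bound * fourier_error N * L ^ 3) \<longlonglongrightarrow> 0"
    by (rule tendsto_eq_intros fourier_error_lim refl | simp)+
qed (use double_conv in auto)

lemma trace_cubed_integral:
  "(\<Sum>i\<in>UNIV. \<Sum>j\<in>UNIV. \<Sum>k\<in>UNIV. I (\<lambda>x. pd i (u j) x * pd j (u k) x * pd k (u i) x)) = 0"
proof (rule LIMSEQ_unique)
  show "(\<lambda>N. \<Sum>i\<in>UNIV. \<Sum>j\<in>UNIV. \<Sum>k\<in>UNIV.
       I (\<lambda>x. pd i (psum N (u j)) x * pd j (psum N (u k)) x * pd k (psum N (u i)) x))
     \<longlonglongrightarrow> (\<Sum>i\<in>UNIV. \<Sum>j\<in>UNIV. \<Sum>k\<in>UNIV. I (\<lambda>x. pd i (u j) x * pd j (u k) x * pd k (u i) x))"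
    by (intro tendsto_sum triple_lim)
  show "(\<lambda>N. \<Sum>i\<in>UNIV. \<Sum>j\<in>UNIV. \<Sum>k\<in>UNIV.
       I (\<lambda>x. pd i (psum N (u j)) x * pd j (psum N (u k)) x * pd k (psum N (u i)) x)) \<longlonglongrightarrow> 0"
    unfolding psum_identities(2)[OF psum_trig] by simp
qed

lemma trace_squared_integral:
  "(\<Sum>i\<in>UNIV. \<Sum>j\<in>UNIV. I (\<lambda>x. pd i (u j) x * pd j (u i) x)) = 0"
proof (rule LIMSEQ_unique)
  show "(\<lambda>N. \<Sum>i\<in>UNIV. \<Sum>j\<in>UNIV. I (\<lambda>x. pd i (psum N (u j)) x * pd j (psum N (u i)) x))
     \<longlonglongrightarrow> (\<Sum>i\<in>UNIV. \<Sum>j\<in>UNIV. I (\<lambda>x. pd i (u j) x * pd j (u i) x))"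
    by (intro tendsto_sum double_lim)
  show "(\<lambda>N. \<Sum>i\<in>UNIV. \<Sum>j\<in>UNIV. I (\<lambda>x. pd i (psum N (u j)) x * pd j (psum N (u i)) x)) \<longlonglongrightarrow> 0"
    unfolding psum_identities(3)[OF psum_trig] by simp
qed

text \<open>
  Up to sign, the rate of change of the gradient energy.
\<close>

definition "stretching = (\<Sum>i\<in>UNIV. \<Sum>j\<in>UNIV. \<Sum>k\<in>UNIV. I (\<lambda>x. pd k (u i) x * pd i (u j) x * pd k (u j) x))"

text \<open>
  The two summands come from the cubic term and from the advection term in \<open>advection_conv\<close>.
\<close>

definition "rate_const = 3 * sup_bound\<^sup>2 * L ^ 3 + 2 * sup_bound * (L ^ 3 + Q\<^sup>2 / L ^ 3)"

text \<open>
  An \<open>L\<^sup>1\<close> bound is enough because the factors multiplied with the second derivatives converge uniformly.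
\<close>

lemma second_derivative_L1: "I (\<lambda>x. \<bar>pd k (pd k (psum N (u j))) x\<bar>) \<le> L ^ 3 + Q\<^sup>2 / L ^ 3"
proof -
  let ?g = "pd k (pd k (psum N (u j)))"
  have "\<bar>y\<bar> \<le> 1 + y\<^sup>2" for y :: real
  proof -
    have "0 \<le> (\<bar>y\<bar> - 1)\<^sup>2 + y\<^sup>2" by simp
    then show ?thesis unfolding power2_diff by simp
  qed
  then have "I (\<lambda>x. \<bar>?g x\<bar>) \<le> I (\<lambda>x. 1 + (?g x)\<^sup>2)"
    by (intro I_mono cell_integrable_continuous continuous_intros field_continuity) auto
  also have "\<dots> = I (\<lambda>x. 1) + I (\<lambda>x. (?g x)\<^sup>2)"
    by (intro Bochner_Integration.integral_add cell_integrable_continuous continuous_intros field_continuity)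
  also have "\<dots> \<le> L ^ 3 + Q\<^sup>2 / L ^ 3"
    unfolding I_const using psum_second_derivative_L2[OF u_energy] by simp
  finally show ?thesis .
qed

lemma advection_term_conv:
  "\<bar>I (\<lambda>x. u i x * pd i (u j) x * pd k (pd k (psum N (u j))) x)
    - I (\<lambda>x. psum N (u i) x * pd i (psum N (u j)) x * pd k (pd k (psum N (u j))) x)\<bar>
   \<le> 2 * sup_bound * (L ^ 3 + Q\<^sup>2 / L ^ 3) * fourier_error N"
proof -
  let ?g = "pd k (pd k (psum N (u j)))"
  let ?d = "\<lambda>x. u i x * pd i (u j) x - psum N (u i) x * pd i (psum N (u j)) x"
  have "I (\<lambda>x. u i x * pd i (u j) x * ?g x) - I (\<lambda>x. psum N (u i) x * pd i (psum N (u j)) x * ?g x)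
      = I (\<lambda>x. u i x * pd i (u j) x * ?g x - psum N (u i) x * pd i (psum N (u j)) x * ?g x)"
    by (intro Bochner_Integration.integral_diff[symmetric] cell_integrable_continuous continuous_intros field_continuity)
  also have "\<dots> = I (\<lambda>x. ?d x * ?g x)" by (simp only: left_diff_distrib)
  finally have "\<bar>I (\<lambda>x. u i x * pd i (u j) x * ?g x) - I (\<lambda>x. psum N (u i) x * pd i (psum N (u j)) x * ?g x)\<bar>
      = \<bar>I (\<lambda>x. ?d x * ?g x)\<bar>" by (rule arg_cong)
  also have "\<dots> \<le> I (\<lambda>x. \<bar>?d x * ?g x\<bar>)" by (rule integral_abs_bound)
  also have "\<dots> \<le> I (\<lambda>x. 2 * sup_bound * fourier_error N * \<bar>?g x\<bar>)"
  proof (rule I_mono)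
    fix x
    have "\<bar>?d x\<bar> \<le> 2 * sup_bound * fourier_error N"
      by (rule double_product_diff_le) (use field_bounds in auto)
    then show "\<bar>?d x * ?g x\<bar> \<le> 2 * sup_bound * fourier_error N * \<bar>?g x\<bar>"
      unfolding abs_mult by (intro mult_right_mono) auto
  qed (intro cell_integrable_continuous continuous_intros field_continuity)+
  also have "\<dots> = 2 * sup_bound * fourier_error N * I (\<lambda>x. \<bar>?g x\<bar>)" by simp
  also have "\<dots> \<le> 2 * sup_bound * fourier_error N * (L ^ 3 + Q\<^sup>2 / L ^ 3)"
    using sup_bound_nonneg fourier_error_nonneg by (intro mult_left_mono second_derivative_L1) auto
  finally show ?thesis by (simp add: mult_ac)
qed

text \<open>
  For the partial sums the energy balance is exact. Replacing them by the field costs a uniformly small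
  factor against a bounded \<open>L\<^sup>1\<close> norm in the advection term, and a uniformly small error in the cubic term.
\<close>

lemma advection_conv:
  "\<bar>(\<Sum>i\<in>UNIV. \<Sum>j\<in>UNIV. \<Sum>k\<in>UNIV. I (\<lambda>x. u i x * pd i (u j) x * pd k (pd k (psum N (u j))) x)) + stretching\<bar>
    \<le> 27 * rate_const * fourier_error N"
proof -
  let ?a = "\<lambda>i j k. I (\<lambda>x. u i x * pd i (u j) x * pd k (pd k (psum N (u j))) x)"
  let ?b = "\<lambda>i j k. I (\<lambda>x. psum N (u i) x * pd i (psum N (u j)) x * pd k (pd k (psum N (u j))) x)"
  let ?c = "\<lambda>i j k. I (\<lambda>x. pd k (psum N (u i)) x * pd i (psum N (u j)) x * pd k (psum N (u j)) x)"
  let ?d = "\<lambda>i j k. I (\<lambda>x. pd k (u i) x * pd i (u j) x * pd k (u j) x)"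
  have bc: "(\<Sum>i\<in>UNIV. \<Sum>j\<in>UNIV. \<Sum>k\<in>UNIV. ?b i j k) = - (\<Sum>i\<in>UNIV. \<Sum>j\<in>UNIV. \<Sum>k\<in>UNIV. ?c i j k)"
    by (rule psum_identities(1)[OF psum_trig])
  have eq: "(\<Sum>i\<in>UNIV. \<Sum>j\<in>UNIV. \<Sum>k\<in>UNIV. ?a i j k) + stretching
      = (\<Sum>i\<in>UNIV. \<Sum>j\<in>UNIV. \<Sum>k\<in>UNIV. (?a i j k - ?b i j k) - (?c i j k - ?d i j k))"
    unfolding sum_subtractf bc stretching_def by simp
  have "\<bar>\<Sum>i\<in>UNIV. \<Sum>j\<in>UNIV. \<Sum>k\<in>UNIV. (?a i j k - ?b i j k) - (?c i j k - ?d i j k)\<bar>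
      \<le> (\<Sum>i\<in>(UNIV::3 set). \<Sum>j\<in>(UNIV::3 set). \<Sum>k\<in>(UNIV::3 set). rate_const * fourier_error N)"
  proof (intro order_trans[OF sum_abs] sum_mono)
    fix i j k
    have "\<bar>(?a i j k - ?b i j k) - (?c i j k - ?d i j k)\<bar> \<le> \<bar>?a i j k - ?b i j k\<bar> + \<bar>?c i j k - ?d i j k\<bar>"
      by (rule abs_triangle_ineq4)
    also have "\<dots> \<le> 2 * sup_bound * (L ^ 3 + Q\<^sup>2 / L ^ 3) * fourier_error N + 3 * sup_bound\<^sup>2 * fourier_error N * L ^ 3"
      by (intro add_mono advection_term_conv triple_conv)
    also have "\<dots> = rate_const * fourier_error N" by (simp add: rate_const_def algebra_simps)
    finally show "\<bar>(?a i j k - ?b i j k) - (?c i j k - ?d i j k)\<bar> \<le> rate_const * fourier_error N" .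
  qed
  then show ?thesis unfolding eq by simp
qed

end

end

section \<open>Evolution of the gradient energy\<close>

context periodic_box
begin

definition gradient_energy :: "(3 \<Rightarrow> real^3 \<Rightarrow> real) \<Rightarrow> real" where
  "gradient_energy u = (\<Sum>i\<in>UNIV. \<Sum>j\<in>UNIV. I (\<lambda>x. pd i (u j) x * pd i (u j) x)) / 2"

text \<open>
  Parseval's identity turns the energy of a partial sum into a finite sum of squares, which can be
  differentiated in time term by term.
\<close>

lemma gradient_energy_psum:
  "gradient_energy (\<lambda>j. psum N (u j)) =
     (\<Sum>i\<in>UNIV. \<Sum>j\<in>UNIV. \<Sum>k\<in>cube N. (wave k $ i)\<^sup>2 * ((ccoef (u j) k)\<^sup>2 + (scoef (u j) k)\<^sup>2)) / (2 * L ^ 3)"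
proof -
  have "I (\<lambda>x. pd i (psum N (u j)) x * pd i (psum N (u j)) x)
      = (\<Sum>k\<in>cube N. (wave k $ i)\<^sup>2 * ((ccoef (u j) k)\<^sup>2 + (scoef (u j) k)\<^sup>2)) / L ^ 3" for i j
  proof -
    let ?a = "\<lambda>k. wave k $ i * (scoef (u j) k / L ^ 3)" and ?b = "\<lambda>k. - (wave k $ i * (ccoef (u j) k / L ^ 3))"
    have "I (\<lambda>x. pd i (psum N (u j)) x * pd i (psum N (u j)) x)
        = L ^ 3 * (\<Sum>k\<in>cube N. ?a k * ?a k + ?b k * ?b k)"
      unfolding psum_def pd_trig
      by (rule I_trig_trig) (auto simp: finite_cube cube_uminus ccoef_uminus scoef_uminus)
    also have "\<dots> = (\<Sum>k\<in>cube N. (wave k $ i)\<^sup>2 * ((ccoef (u j) k)\<^sup>2 + (scoef (u j) k)\<^sup>2)) / L ^ 3"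
      unfolding sum_distrib_left sum_divide_distrib
    proof (intro sum.cong refl)
      fix k
      have "d * (w * (y / d) * (w * (y / d)) + - (w * (x / d)) * - (w * (x / d))) = w\<^sup>2 * (x\<^sup>2 + y\<^sup>2) / d"
        if "d \<noteq> 0" for d w x y :: real
        using that by (simp add: power2_eq_square field_simps)
      from this[of "L ^ 3"] show "L ^ 3 * (?a k * ?a k + ?b k * ?b k)
          = (wave k $ i)\<^sup>2 * ((ccoef (u j) k)\<^sup>2 + (scoef (u j) k)\<^sup>2) / L ^ 3"
        by this (use L_pos in simp)
    qed
    finally show ?thesis .
  qed
  then show ?thesis by (simp add: gradient_energy_def sum_divide_distrib mult.commute)
qed

context
  fixes T :: real and m :: nat and v0 :: "real^3 \<Rightarrow> real^3"
    and v :: "real \<Rightarrow> real^3 \<Rightarrow> real^3" and p :: "real \<Rightarrow> real^3 \<Rightarrow> real"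
  assumes m: "3 \<le> m" and euler: "classical_euler_solution L T m v0 v p"
begin

definition "vel t j = (\<lambda>x. v t x $ j)"
definition "accel t j = (\<lambda>x. time_derivative T v t x $ j)"

lemma vel_sobolev: "t \<in> {0..<T} \<Longrightarrow> v t \<in> sobolev_sigma L m"
  using euler by (simp add: classical_euler_solution_def sobolev_continuous_def)

lemma vel_L2: "t \<in> {0..<T} \<Longrightarrow> L2_per L (vel t j)"
  using vel_sobolev[of t] by (simp add: sobolev_sigma_def sobolev_def vel_def)

lemma vel_integrable: "t \<in> {0..<T} \<Longrightarrow> cell_integrable (vel t j)"
  using L2_per_integrable(1)[OF vel_L2] .

lemma vel_weak: "t \<in> {0..<T} \<Longrightarrow> length js \<le> m \<Longrightarrow> \<exists>w. weak_derivative L js (vel t j) w"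
  using vel_sobolev[of t] by (simp add: sobolev_sigma_def sobolev_def vel_def)

lemma vel_continuous: "t \<in> {0..<T} \<Longrightarrow> continuous_on UNIV (vel t j)"
proof -
  assume "t \<in> {0..<T}"
  then have "continuous_on UNIV (v t)"
    using euler by (intro differentiable_continuous_UNIV) (simp add: classical_euler_solution_def)
  then show ?thesis unfolding vel_def by (intro continuous_intros)
qed

text \<open>
  The weak divergence condition, tested with plane waves.
\<close>

lemma vel_div_coef:
  assumes t: "t \<in> {0..<T}"
  shows "(\<Sum>i\<in>UNIV. wave k $ i * ccoef (vel t i) k) = 0" "(\<Sum>i\<in>UNIV. wave k $ i * scoef (vel t i) k) = 0"
proof -
  have z: "(\<Sum>i\<in>UNIV. wave k $ i * b * ccoef (vel t i) k + - (wave k $ i * a) * scoef (vel t i) k) = 0" for a b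
  proof -
    let ?\<phi> = "trig {k} (\<lambda>_. a) (\<lambda>_. b)"
    have "0 = I (\<lambda>x. \<Sum>j\<in>UNIV. vel t j x * pd j ?\<phi> x)"
      using vel_sobolev[OF t] test_function_trig[of "{k}" "\<lambda>_. a" "\<lambda>_. b"]
      by (simp add: sobolev_sigma_def I_eq_set_integral vel_def)
    also have "\<dots> = (\<Sum>j\<in>UNIV. I (\<lambda>x. vel t j x * pd j ?\<phi> x))"
      unfolding pd_trig by (intro Bochner_Integration.integral_sum cell_integrable_mult_trig vel_integrable t)
    also have "\<dots> = (\<Sum>i\<in>UNIV. wave k $ i * b * ccoef (vel t i) k + - (wave k $ i * a) * scoef (vel t i) k)"
      unfolding pd_trig I_mult_trig[OF vel_integrable[OF t]] by simp
    finally show ?thesis ..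
  qed
  show "(\<Sum>i\<in>UNIV. wave k $ i * ccoef (vel t i) k) = 0" using z[of 1 0] by simp
  show "(\<Sum>i\<in>UNIV. wave k $ i * scoef (vel t i) k) = 0" using z[of 0 1] by (simp add: sum_negf)
qed

text \<open>
  Continuity in time with values in the Sobolev space bounds the energy near each time by one constant, so
  that all estimates hold uniformly there.
\<close>

lemma locally_bounded_energy:
  assumes t: "t \<in> {0..<T}"
  obtains Q \<delta> where "\<delta> > 0" "\<And>s. s \<in> {0..<T} \<Longrightarrow> \<bar>s - t\<bar> < \<delta> \<Longrightarrow> finite_energy_field Q (vel s)"
proof -
  \<comment> \<open>\<open>Q\<^sup>2\<close> is twice the energy bound at time \<open>t\<close> plus twice the bound for a difference of Sobolev norm at most \<open>1\<close>.\<close>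
  define Q where "Q = sqrt (2 * (L ^ 3 * (sobolev_norm L m (v t))\<^sup>2) + 2 * (L ^ 3 * 1))"
  have Q2: "Q\<^sup>2 = 2 * (L ^ 3 * (sobolev_norm L m (v t))\<^sup>2) + 2 * (L ^ 3 * 1)"
    unfolding Q_def using L_pos by simp
  have "((\<lambda>s. sobolev_norm L m (\<lambda>x. v s x - v t x)) \<longlongrightarrow> 0) (at t within {0..<T})"
    using euler t by (simp add: classical_euler_solution_def sobolev_continuous_def)
  then have "\<forall>\<^sub>F s in at t within {0..<T}. sobolev_norm L m (\<lambda>x. v s x - v t x) < 1"
    by (rule order_tendstoD) simp
  then obtain \<delta> where \<delta>: "\<delta> > 0"
      "\<And>s. s \<in> {0..<T} \<Longrightarrow> s \<noteq> t \<Longrightarrow> dist s t < \<delta> \<Longrightarrow> sobolev_norm L m (\<lambda>x. v s x - v t x) < 1"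
    unfolding eventually_at by auto
  have "finite_energy_field Q (vel s)" if s: "s \<in> {0..<T}" "\<bar>s - t\<bar> < \<delta>" for s
    unfolding finite_energy_field_def
  proof (intro conjI allI)
    show "0 \<le> Q" unfolding Q_def using L_pos by simp
    show "continuous_on UNIV (vel s j)" for j using s(1) by (rule vel_continuous)
    show "periodic L (vel s j)" for j using vel_L2[OF s(1)] by (simp add: L2_per_def)
    show "(\<Sum>i\<in>UNIV. wave k $ i * ccoef (vel s i) k) = 0" "(\<Sum>i\<in>UNIV. wave k $ i * scoef (vel s i) k) = 0" for k
      using vel_div_coef[OF s(1)] by auto
    have et: "sobolev_energy N (vel t j) \<le> L ^ 3 * (sobolev_norm L m (v t))\<^sup>2" for N j
      using sobolev_energy_le_norm[OF _ m, of "v t"] vel_weak[OF t] by (simp add: vel_def)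
    show "sobolev_energy N (vel s j) \<le> Q\<^sup>2" for j N
    proof (cases "s = t")
      case True
      have "0 \<le> L ^ 3" using L_pos by simp
      moreover have "0 \<le> L ^ 3 * (sobolev_norm L m (v t))\<^sup>2" using L_pos by simp
      ultimately show ?thesis using et[of N j] unfolding Q2 True by linarith
    next
      case False
      let ?d = "\<lambda>x. v s x - v t x"
      have "sobolev_norm L m ?d < 1" using \<delta>(2)[OF s(1) False] s(2) by (simp add: dist_real_def)
      moreover have "0 \<le> sobolev_norm L m ?d" unfolding sobolev_norm_def I_eq_set_integral
        by (intro real_sqrt_ge_zero sum_nonneg integral_nonneg_AE) simp
      ultimately have n1: "(sobolev_norm L m ?d)\<^sup>2 \<le> 1" by (simp add: power_le_one)
      have wd: "\<exists>w. weak_derivative L js (\<lambda>y. ?d y $ i) w" if "length js \<le> m" for i js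
        using vel_weak[OF s(1) that, of i] vel_weak[OF t that, of i]
          weak_derivative_diff[OF vel_integrable[OF s(1)] vel_integrable[OF t], of js i _ i]
        unfolding vel_def vector_minus_component by blast
      have "sobolev_energy N (\<lambda>x. vel s j x - vel t j x) \<le> L ^ 3 * (sobolev_norm L m ?d)\<^sup>2"
        using sobolev_energy_le_norm[OF wd m, of N j] by (simp add: vel_def)
      also have "\<dots> \<le> L ^ 3 * 1" using n1 L_pos by (intro mult_left_mono) auto
      finally have "sobolev_energy N (\<lambda>x. vel s j x - vel t j x) \<le> L ^ 3 * 1" .
      then show ?thesis
        unfolding Q2 using sobolev_energy_diff[OF vel_integrable[OF s(1)] vel_integrable[OF t], of N j j] et[of N j] by linarith
    qed
  qed
  then show thesis using that \<delta>(1) by blast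
qed

lemma vel_has_derivative:
  assumes "t \<in> {0..<T}"
  shows "((\<lambda>s. vel s j x) has_real_derivative accel t j x) (at t within {0..<T})"
proof -
  have "(\<lambda>s. v s x) differentiable at t within {0..<T}"
    using euler assms by (simp add: classical_euler_solution_def)
  then have "((\<lambda>s. v s x) has_vector_derivative time_derivative T v t x) (at t within {0..<T})"
    unfolding time_derivative_def by (simp add: vector_derivative_works)
  from bounded_linear.has_vector_derivative[OF bounded_linear_vec_nth this, of j]
  show ?thesis by (simp add: vel_def accel_def has_real_derivative_iff_has_vector_derivative)
qed

lemma accel_continuous_joint: "continuous_on ({0..<T} \<times> UNIV) (\<lambda>(t, x). accel t j x)"
proof -
  have "continuous_on ({0..<T} \<times> UNIV) (\<lambda>z. (case z of (t, x) \<Rightarrow> time_derivative T v t x) $ j)"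
    using euler by (intro continuous_intros) (simp add: classical_euler_solution_def)
  then show ?thesis by (simp add: accel_def case_prod_beta)
qed

lemma accel_continuous:
  assumes "t \<in> {0..<T}" shows "continuous_on UNIV (accel t j)"
proof -
  have "continuous_on UNIV (\<lambda>x. case (t, x) of (t, x) \<Rightarrow> accel t j x)"
    by (rule continuous_on_compose2[OF accel_continuous_joint]) (use assms in \<open>auto intro!: continuous_intros\<close>)
  then show ?thesis by simp
qed

text \<open>
  Differentiation under the integral sign, from the joint continuity of the time derivative.
\<close>

lemma integral_vel_has_derivative:
  assumes t: "t \<in> {0..<T}" and g: "continuous_on UNIV g"
  shows "((\<lambda>s. I (\<lambda>x. vel s j x * g x)) has_real_derivative I (\<lambda>x. accel t j x * g x)) (at t within {0..<T})"
proof -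
  have cv: "continuous_on UNIV (\<lambda>x. vel s j x * g x)" if "s \<in> {0..<T}" for s
    by (intro continuous_intros vel_continuous that g)
  have ca: "continuous_on UNIV (\<lambda>x. accel t j x * g x)"
    by (intro continuous_intros accel_continuous t g)
  have HK: "I f = integral (cbox 0 (\<chi> i. L)) f" if "continuous_on UNIV f" for f
    using I_eq_HK[OF cell_integrable_continuous[OF that]] by (simp add: cell_def)
  have "((\<lambda>s. integral (cbox 0 (\<chi> i. L)) (\<lambda>x. vel s j x * g x)) has_real_derivative
      integral (cbox 0 (\<chi> i. L)) (\<lambda>x. accel t j x * g x)) (at t within {0..<T})"
  proof (rule leibniz_rule_field_derivative)
    show "((\<lambda>s. vel s j x * g x) has_real_derivative accel s j x * g x) (at s within {0..<T})"
      if "s \<in> {0..<T}" for s x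
      by (rule DERIV_cmult_right) (rule vel_has_derivative[OF that])
    show "(\<lambda>x. vel s j x * g x) integrable_on cbox 0 (\<chi> i. L)" if "s \<in> {0..<T}" for s
      by (rule integrable_continuous) (rule continuous_on_subset[OF cv[OF that]], simp)
    have "continuous_on ({0..<T} \<times> cbox 0 (\<chi> i. L)) (\<lambda>z. (case z of (t, x) \<Rightarrow> accel t j x) * g (snd z))"
      by (intro continuous_on_mult continuous_on_subset[OF accel_continuous_joint]
          continuous_on_compose2[OF g] continuous_intros) auto
    then show "continuous_on ({0..<T} \<times> cbox 0 (\<chi> i. L)) (\<lambda>(s, x). accel s j x * g x)"
      by (simp add: case_prod_beta)
  qed (use t in \<open>auto intro: convex_real_interval\<close>)
  then show ?thesis
    unfolding HK[OF ca]
    by (rule has_field_derivative_transform_within[where d=1]) (use t in \<open>auto simp: HK cv\<close>)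
qed

lemma ccoef_has_derivative:
    "t \<in> {0..<T} \<Longrightarrow> ((\<lambda>s. ccoef (vel s j) k) has_real_derivative ccoef (accel t j) k) (at t within {0..<T})"
  and scoef_has_derivative:
    "t \<in> {0..<T} \<Longrightarrow> ((\<lambda>s. scoef (vel s j) k) has_real_derivative scoef (accel t j) k) (at t within {0..<T})"
  unfolding ccoef_def scoef_def by (rule integral_vel_has_derivative; simp add: cont_cos cont_sin)+

text \<open>
  Minus the inner product of the acceleration with the Laplacian of the truncated velocity.
\<close>

definition "truncated_rate N t =
  - (\<Sum>i\<in>UNIV. \<Sum>j\<in>UNIV. I (\<lambda>x. accel t j x * pd i (pd i (psum N (vel t j))) x))"

lemma truncated_energy_has_derivative:
  assumes t: "t \<in> {0..<T}"
  shows "((\<lambda>s. gradient_energy (\<lambda>j. psum N (vel s j))) has_real_derivative truncated_rate N t) (at t within {0..<T})"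
proof -
  have "((\<lambda>s. gradient_energy (\<lambda>j. psum N (vel s j))) has_real_derivative
     (\<Sum>i\<in>UNIV. \<Sum>j\<in>UNIV. \<Sum>k\<in>cube N. (wave k $ i)\<^sup>2 *
        (2 * ccoef (vel t j) k * ccoef (accel t j) k + 2 * scoef (vel t j) k * scoef (accel t j) k)) / (2 * L ^ 3))
     (at t within {0..<T})"
    unfolding gradient_energy_psum
    by (intro DERIV_cdivide DERIV_sum DERIV_cmult DERIV_add)
       (auto intro!: derivative_eq_intros ccoef_has_derivative scoef_has_derivative t)
  also have "(\<Sum>i\<in>UNIV. \<Sum>j\<in>UNIV. \<Sum>k\<in>cube N. (wave k $ i)\<^sup>2 *
        (2 * ccoef (vel t j) k * ccoef (accel t j) k + 2 * scoef (vel t j) k * scoef (accel t j) k)) / (2 * L ^ 3)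
      = truncated_rate N t"
  proof -
    have "I (\<lambda>x. accel t j x * pd i (pd i (psum N (vel t j))) x)
       = - (\<Sum>k\<in>cube N. (wave k $ i)\<^sup>2 *
        (2 * ccoef (vel t j) k * ccoef (accel t j) k + 2 * scoef (vel t j) k * scoef (accel t j) k)) / (2 * L ^ 3)" for i j
    proof -
      have "I (\<lambda>x. accel t j x * pd i (pd i (psum N (vel t j))) x)
        = (\<Sum>k\<in>cube N. wave k $ i * - (wave k $ i * (ccoef (vel t j) k / L ^ 3)) * ccoef (accel t j) k
           + - (wave k $ i * (wave k $ i * (scoef (vel t j) k / L ^ 3))) * scoef (accel t j) k)"
        unfolding psum_def pd_trig
        by (rule I_mult_trig) (intro cell_integrable_continuous accel_continuous t)
      also have "\<dots> = (\<Sum>k\<in>cube N. - ((wave k $ i)\<^sup>2 *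
        (2 * ccoef (vel t j) k * ccoef (accel t j) k + 2 * scoef (vel t j) k * scoef (accel t j) k) / (2 * L ^ 3)))"
      proof (intro sum.cong refl)
        fix k
        have "w * - (w * (x / d)) * x' + - (w * (w * (y / d))) * y' = - (w\<^sup>2 * (2 * x * x' + 2 * y * y') / (2 * d))"
          if "d \<noteq> 0" for w x x' y y' d :: real
          using that by (simp add: power2_eq_square field_simps)
        from this[of "L ^ 3"] show "wave k $ i * - (wave k $ i * (ccoef (vel t j) k / L ^ 3)) * ccoef (accel t j) k
           + - (wave k $ i * (wave k $ i * (scoef (vel t j) k / L ^ 3))) * scoef (accel t j) k
           = - ((wave k $ i)\<^sup>2 *
        (2 * ccoef (vel t j) k * ccoef (accel t j) k + 2 * scoef (vel t j) k * scoef (accel t j) k) / (2 * L ^ 3))"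
          by this (use L_pos in simp)
      qed
      finally show ?thesis by (simp add: sum_negf sum_divide_distrib)
    qed
    then show ?thesis by (simp add: truncated_rate_def sum_negf sum_divide_distrib)
  qed
  finally show ?thesis .
qed

text \<open>
  The Laplacian of the truncated velocity is divergence-free, so the pressure gradient drops out and only the
  advection term remains. The equation itself shows that the pressure is continuously differentiable.
\<close>

lemma truncated_rate_eq:
  assumes t: "t \<in> {0..<T}" and fe: "finite_energy_field Q (vel t)"
  shows "truncated_rate N t = (\<Sum>i\<in>UNIV. \<Sum>j\<in>UNIV. \<Sum>k\<in>UNIV.
     I (\<lambda>x. vel t i x * pd i (vel t j) x * pd k (pd k (psum N (vel t j))) x))"
proof -
  let ?g = "\<lambda>k j. pd k (pd k (psum N (vel t j)))"
  note uC1 = u_C1[OF fe]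
  have gC1: "C1_periodic (?g k j)" for k j unfolding psum_def pd_trig by (rule C1_trig)
  have eq: "pd j (p t) x = - accel t j x - (\<Sum>i\<in>UNIV. vel t i x * pd i (vel t j) x)" for j x
  proof -
    have "time_derivative T v t x + advection (v t) x = - grad (p t) x"
      using euler t by (simp add: classical_euler_solution_def)
    then have "(time_derivative T v t x + advection (v t) x) $ j = (- grad (p t) x) $ j" by simp
    then show ?thesis by (simp add: advection_def grad_def accel_def vel_def)
  qed
  \<comment> \<open>The other two terms of the equation are continuous in space, hence so is the pressure gradient.\<close>
  have pc: "continuous_on UNIV (pd j (p t))" for j
    unfolding eq[abs_def] by (intro continuous_intros accel_continuous t C1_continuous C1_pd_continuous uC1)
  have pC1: "C1_periodic (p t)"
    using euler t pc by (simp add: C1_periodic_def classical_euler_solution_def)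
  have gdiv: "(\<Sum>j\<in>UNIV. pd j (?g k j) x) = 0" for k x
  proof -
    have C: "C1_periodic (pd j (psum N (vel t j)))" "C1_periodic (pd k (pd j (psum N (vel t j))))" for j
      unfolding psum_def pd_trig by (rule C1_trig)+
    have "(\<Sum>j\<in>UNIV. pd k (pd j (psum N (vel t j))) x) = 0" for x
      by (rule pd_sum_eq_0[OF C(1) psum_div[OF fe]])
    then have "(\<Sum>j\<in>UNIV. pd k (pd k (pd j (psum N (vel t j)))) x) = 0"
      by (rule pd_sum_eq_0[OF C(2)])
    moreover have "pd j (?g k j) = pd k (pd k (pd j (psum N (vel t j))))" for j
      unfolding psum_def pd_trig by (simp add: mult.left_commute)
    ultimately show ?thesis by simp
  qed
  have cont: "continuous_on UNIV (vel t i)" "continuous_on UNIV (pd i (vel t j))" "continuous_on UNIV (?g k j)"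
      "continuous_on UNIV (pd j (p t))" for i j k
    using C1_continuous[OF uC1] C1_pd_continuous[OF uC1] C1_continuous[OF gC1] pc by auto
  have "- I (\<lambda>x. accel t j x * ?g k j x)
      = (\<Sum>i\<in>UNIV. I (\<lambda>x. vel t i x * pd i (vel t j) x * ?g k j x)) + I (\<lambda>x. ?g k j x * pd j (p t) x)" for k j
  proof -
    have "(\<lambda>x. accel t j x * ?g k j x)
        = (\<lambda>x. - ((\<Sum>i\<in>UNIV. vel t i x * pd i (vel t j) x * ?g k j x) + ?g k j x * pd j (p t) x))"
      unfolding eq by (simp add: fun_eq_iff algebra_simps sum_distrib_left)
    then have "- I (\<lambda>x. accel t j x * ?g k j x)
        = I (\<lambda>x. (\<Sum>i\<in>UNIV. vel t i x * pd i (vel t j) x * ?g k j x) + ?g k j x * pd j (p t) x)"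
      by (simp only: Bochner_Integration.integral_minus minus_minus)
    also have "\<dots> = I (\<lambda>x. \<Sum>i\<in>UNIV. vel t i x * pd i (vel t j) x * ?g k j x) + I (\<lambda>x. ?g k j x * pd j (p t) x)"
      by (intro Bochner_Integration.integral_add cell_integrable_continuous continuous_intros cont)
    also have "I (\<lambda>x. \<Sum>i\<in>UNIV. vel t i x * pd i (vel t j) x * ?g k j x)
        = (\<Sum>i\<in>UNIV. I (\<lambda>x. vel t i x * pd i (vel t j) x * ?g k j x))"
      by (intro I_sum_continuous continuous_intros cont)
    finally show ?thesis .
  qed
  then have "truncated_rate N t = (\<Sum>k\<in>UNIV. \<Sum>j\<in>UNIV. \<Sum>i\<in>UNIV. I (\<lambda>x. vel t i x * pd i (vel t j) x * ?g k j x))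
      + (\<Sum>k\<in>UNIV. \<Sum>j\<in>UNIV. I (\<lambda>x. ?g k j x * pd j (p t) x))"
    unfolding truncated_rate_def by (simp add: sum_negf[symmetric] sum.distrib)
  also have "(\<Sum>k\<in>UNIV. \<Sum>j\<in>UNIV. I (\<lambda>x. ?g k j x * pd j (p t) x)) = 0"
    by (simp add: gradient_orthogonal[OF pC1 gC1 gdiv])
  also have "(\<Sum>k\<in>UNIV. \<Sum>j\<in>UNIV. \<Sum>i\<in>UNIV. I (\<lambda>x. vel t i x * pd i (vel t j) x * ?g k j x))
      = (\<Sum>i\<in>UNIV. \<Sum>j\<in>UNIV. \<Sum>k\<in>UNIV. I (\<lambda>x. vel t i x * pd i (vel t j) x * ?g k j x))"
    by (subst sum.swap, subst (2) sum.swap, subst sum.swap) (rule refl)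
  finally show ?thesis by simp
qed

text \<open>
  The truncated energies converge, and their derivatives converge uniformly near each time.
\<close>

lemma gradient_energy_has_derivative:
  assumes t: "t \<in> {0..<T}"
  shows "((\<lambda>s. gradient_energy (vel s)) has_real_derivative - stretching (vel t)) (at t within {0..<T})"
proof -
  obtain Q \<delta> where \<delta>: "\<delta> > 0" and fe: "\<And>s. s \<in> {0..<T} \<Longrightarrow> \<bar>s - t\<bar> < \<delta> \<Longrightarrow> finite_energy_field Q (vel s)"
    using locally_bounded_energy[OF t] by blast
  define S where "S = {0..<T} \<inter> {t - \<delta><..<t + \<delta>}"
  have S: "s \<in> {0..<T}" "finite_energy_field Q (vel s)" if "s \<in> S" for s
    using that fe[of s] by (auto simp: S_def)
  have tS: "t \<in> S" using t \<delta> by (simp add: S_def)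
  let ?E = "\<lambda>N s. gradient_energy (\<lambda>j. psum N (vel s j))"
  have lim: "(\<lambda>N. ?E N s) \<longlonglongrightarrow> gradient_energy (vel s)" if "s \<in> S" for s
    unfolding gradient_energy_def by (intro tendsto_divide tendsto_sum double_lim[OF S(2)[OF that]] tendsto_const) simp
  have "\<exists>G. \<forall>s\<in>S. (\<lambda>N. ?E N s) \<longlonglongrightarrow> G s \<and> (G has_derivative (*) (- stretching (vel s))) (at s within S)"
  proof (rule has_derivative_sequence)
    show "convex S" unfolding S_def by (intro convex_Int convex_real_interval)
    show "(?E N has_derivative (*) (truncated_rate N s)) (at s within S)" if "s \<in> S" for N s
      using truncated_energy_has_derivative[OF S(1)[OF that], of N] unfolding has_field_derivative_def
      by (rule has_derivative_subset) (simp add: S_def)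
    show "t \<in> S" by (rule tS)
    show "(\<lambda>N. ?E N t) \<longlonglongrightarrow> gradient_energy (vel t)" by (rule lim[OF tS])
    fix e :: real assume e: "e > 0"
    have "(\<lambda>N. 27 * rate_const Q * fourier_error Q N) \<longlonglongrightarrow> 0"
      by (rule tendsto_eq_intros fourier_error_lim[OF S(2)[OF tS]] refl | simp)+
    then have "\<forall>\<^sub>F N in sequentially. 27 * rate_const Q * fourier_error Q N < e" using e by (rule order_tendstoD)
    then show "\<forall>\<^sub>F N in sequentially. \<forall>s\<in>S. \<forall>h. norm (truncated_rate N s * h - - stretching (vel s) * h) \<le> e * norm h"
    proof (eventually_elim, intro ballI allI)
      fix N s and h :: real assume N: "27 * rate_const Q * fourier_error Q N < e" and s: "s \<in> S"
      have "\<bar>truncated_rate N s + stretching (vel s)\<bar> \<le> e"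
        using advection_conv[OF S(2)[OF s], of N] N truncated_rate_eq[OF S[OF s], of N] by linarith
      moreover have "truncated_rate N s * h - - stretching (vel s) * h = (truncated_rate N s + stretching (vel s)) * h"
        by (simp add: algebra_simps)
      ultimately show "norm (truncated_rate N s * h - - stretching (vel s) * h) \<le> e * norm h"
        by (simp add: abs_mult mult_right_mono)
    qed
  qed
  then obtain G where G: "\<And>s. s \<in> S \<Longrightarrow> (\<lambda>N. ?E N s) \<longlonglongrightarrow> G s"
      "\<And>s. s \<in> S \<Longrightarrow> (G has_derivative (*) (- stretching (vel s))) (at s within S)" by blast
  have GE: "G s = gradient_energy (vel s)" if "s \<in> S" for s
    using LIMSEQ_unique[OF G(1)[OF that] lim[OF that]] .
  have "((\<lambda>s. gradient_energy (vel s)) has_real_derivative - stretching (vel t)) (at t within S)"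
    by (rule has_field_derivative_transform_within[where f=G and d=1])
       (use G(2)[OF tS] tS GE in \<open>auto simp: has_field_derivative_def\<close>)
  moreover have "at t within S = at t within {0..<T}"
    unfolding S_def using \<delta> by (intro at_within_nhd[where S="{t - \<delta><..<t + \<delta>}"]) auto
  ultimately show ?thesis by simp
qed

end

end

section \<open>Eigenvalues of the deformation tensor\<close>

text \<open>
  The coefficients of the characteristic polynomial, compared through its values at \<open>0\<close>, \<open>1\<close> and \<open>-1\<close>.
\<close>

lemma eigenvalues3_symmetric_functions:
  fixes A :: "real^3^3"
  assumes "eigenvalues3 A a b c"
  shows "a + b + c = A$1$1 + A$2$2 + A$3$3"
    and "a * b + b * c + c * a = A$1$1 * A$2$2 + A$2$2 * A$3$3 + A$3$3 * A$1$1
           - A$1$2 * A$2$1 - A$2$3 * A$3$2 - A$3$1 * A$1$3"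
    and "a * b * c = det A"
proof -
  have e: "det (mat z - A) = (z - a) * (z - b) * (z - c)" for z
    using assms by (simp add: eigenvalues3_def)
  have 0: "a * b * c = det A"
    using e[of 0] by (simp add: det_3 mat_def algebra_simps)
  have 1: "(1 - a) * (1 - b) * (1 - c) = det (mat 1 - A)" using e[of 1] by simp
  have 2: "(- 1 - a) * (- 1 - b) * (- 1 - c) = det (mat (- 1) - A)" using e[of "- 1"] by simp
  show "a * b * c = det A" by (rule 0)
  show "a + b + c = A$1$1 + A$2$2 + A$3$3"
    using 0 1 2 by (simp add: det_3 mat_def algebra_simps)
  show "a * b + b * c + c * a = A$1$1 * A$2$2 + A$2$2 * A$3$3 + A$3$3 * A$1$1
           - A$1$2 * A$2$1 - A$2$3 * A$3$2 - A$3$1 * A$1$3"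
    using 0 1 2 by (simp add: det_3 mat_def algebra_simps)
qed

text \<open>
  For a trace-free symmetric matrix \<open>S\<close>, the sum of the squared eigenvalues is \<open>tr S\<^sup>2\<close> and three times their
  product is \<open>tr S\<^sup>3\<close>; expanding \<open>S = (G + G\<^sup>T) / 2\<close> gives the two formulas.
\<close>

lemma eigenvalues3_symmetric_part:
  fixes G :: "3 \<Rightarrow> 3 \<Rightarrow> real"
  assumes ev: "eigenvalues3 (\<chi> i j. (G i j + G j i) / 2) a b c" and tr: "(\<Sum>i\<in>UNIV. G i i) = 0"
  shows "a\<^sup>2 + b\<^sup>2 + c\<^sup>2 = (\<Sum>i\<in>UNIV. \<Sum>j\<in>UNIV. G i j * G i j) / 2 + (\<Sum>i\<in>UNIV. \<Sum>j\<in>UNIV. G i j * G j i) / 2"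
    and "4 * (a * b * c) = (\<Sum>i\<in>UNIV. \<Sum>j\<in>UNIV. \<Sum>k\<in>UNIV. G i j * G j k * G k i) / 3
           + (\<Sum>i\<in>UNIV. \<Sum>j\<in>UNIV. \<Sum>k\<in>UNIV. G k i * G i j * G k j)"
proof -
  note s = eigenvalues3_symmetric_functions[OF ev]
  have g33: "G 3 3 = - G 1 1 - G 2 2" using tr by (simp add: sum_3)
  have "a\<^sup>2 + b\<^sup>2 + c\<^sup>2 = (a + b + c)\<^sup>2 - 2 * (a * b + b * c + c * a)"
    by (simp add: power2_eq_square algebra_simps)
  also have "\<dots> = (\<Sum>i\<in>UNIV. \<Sum>j\<in>UNIV. G i j * G i j) / 2 + (\<Sum>i\<in>UNIV. \<Sum>j\<in>UNIV. G i j * G j i) / 2"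
    unfolding s by (simp add: sum_3 power2_eq_square field_simps)
  finally show "a\<^sup>2 + b\<^sup>2 + c\<^sup>2 = (\<Sum>i\<in>UNIV. \<Sum>j\<in>UNIV. G i j * G i j) / 2 + (\<Sum>i\<in>UNIV. \<Sum>j\<in>UNIV. G i j * G j i) / 2" .
  show "4 * (a * b * c) = (\<Sum>i\<in>UNIV. \<Sum>j\<in>UNIV. \<Sum>k\<in>UNIV. G i j * G j k * G k i) / 3
           + (\<Sum>i\<in>UNIV. \<Sum>j\<in>UNIV. \<Sum>k\<in>UNIV. G k i * G i j * G k j)"
    unfolding s(3) by (simp add: det_3 sum_3 g33 field_simps)
qed

theorem theorem2p1:
  fixes L T :: real and m :: nat
    and v0 :: "real^3 \<Rightarrow> real^3"
    and v :: "real \<Rightarrow> real^3 \<Rightarrow> real^3"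
    and p :: "real \<Rightarrow> real^3 \<Rightarrow> real"
    and ev1 ev2 ev3 :: "real \<Rightarrow> real^3 \<Rightarrow> real"
  assumes "L > 0" and "T > 0" and "real m > 5 / 2"
    and "classical_euler_solution L T m v0 v p"
    and "\<And>t x. t \<in> {0..<T} \<Longrightarrow>
           eigenvalues3 (deformation (v t) x) (ev1 t x) (ev2 t x) (ev3 t x)"
  shows "\<forall>t\<in>{0..<T}.
    ((\<lambda>s. LINT x:cell L|lebesgue. (ev1 s x)\<^sup>2 + (ev2 s x)\<^sup>2 + (ev3 s x)\<^sup>2)
       has_real_derivative
       - 4 * (LINT x:cell L|lebesgue. ev1 t x * ev2 t x * ev3 t x))
      (at t within {0..<T})"
proof
  fix t assume t: "t \<in> {0..<T}"
  interpret periodic_box L by unfold_locales (rule assms(1))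
  have m: "3 \<le> m" using assms(3) by linarith
  note euler = assms(4)
  define u where "u = (\<lambda>s (j::3) x. v s x $ j)"
  have u: "u = vel v" by (simp add: u_def fun_eq_iff vel_def[OF m euler])
  have fe: "\<exists>Q. finite_energy_field Q (u s)" if "s \<in> {0..<T}" for s
    using locally_bounded_energy[OF m euler that] that unfolding u by (metis abs_zero diff_self)
  have div: "(\<Sum>i\<in>UNIV. pd i (u s i) x) = 0" if "s \<in> {0..<T}" for s x
    using euler that by (simp add: classical_euler_solution_def divergence_def u_def)
  have ev: "eigenvalues3 (\<chi> i j. (pd i (u s j) x + pd j (u s i) x) / 2) (ev1 s x) (ev2 s x) (ev3 s x)"
    if "s \<in> {0..<T}" for s x
    using assms(5)[OF that, of x] by (simp add: deformation_def u_def)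
  have square: "(LINT x:cell L|lebesgue. (ev1 s x)\<^sup>2 + (ev2 s x)\<^sup>2 + (ev3 s x)\<^sup>2) = gradient_energy (u s)"
    if s: "s \<in> {0..<T}" for s
  proof -
    obtain Q where Q: "finite_energy_field Q (u s)" using fe[OF s] by blast
    note c = C1_pd_continuous[OF u_C1[OF Q]]
    have "(LINT x:cell L|lebesgue. (ev1 s x)\<^sup>2 + (ev2 s x)\<^sup>2 + (ev3 s x)\<^sup>2)
        = I (\<lambda>x. (\<Sum>i\<in>UNIV. \<Sum>j\<in>UNIV. pd i (u s j) x * pd i (u s j) x) / 2
            + (\<Sum>i\<in>UNIV. \<Sum>j\<in>UNIV. pd i (u s j) x * pd j (u s i) x) / 2)"
      unfolding I_eq_set_integral eigenvalues3_symmetric_part(1)[OF ev[OF s] div[OF s]] ..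
    also have "\<dots> = I (\<lambda>x. \<Sum>i\<in>UNIV. \<Sum>j\<in>UNIV. pd i (u s j) x * pd i (u s j) x) / 2
            + I (\<lambda>x. \<Sum>i\<in>UNIV. \<Sum>j\<in>UNIV. pd i (u s j) x * pd j (u s i) x) / 2"
      by (subst Bochner_Integration.integral_add)
         (auto intro!: cell_integrable_continuous continuous_intros c)
    also have "\<dots> = gradient_energy (u s) + (\<Sum>i\<in>UNIV. \<Sum>j\<in>UNIV. I (\<lambda>x. pd i (u s j) x * pd j (u s i) x)) / 2"
      unfolding gradient_energy_def by (simp add: I_sum_continuous c continuous_intros)
    finally show ?thesis unfolding trace_squared_integral[OF Q] by simp
  qed
  have product: "4 * (LINT x:cell L|lebesgue. ev1 t x * ev2 t x * ev3 t x) = stretching (u t)"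
  proof -
    obtain Q where Q: "finite_energy_field Q (u t)" using fe[OF t] by blast
    note c = C1_pd_continuous[OF u_C1[OF Q]]
    have "4 * (LINT x:cell L|lebesgue. ev1 t x * ev2 t x * ev3 t x) = I (\<lambda>x. 4 * (ev1 t x * ev2 t x * ev3 t x))"
      unfolding I_eq_set_integral by simp
    also have "\<dots> = I (\<lambda>x. (\<Sum>i\<in>UNIV. \<Sum>j\<in>UNIV. \<Sum>k\<in>UNIV. pd i (u t j) x * pd j (u t k) x * pd k (u t i) x) / 3
           + (\<Sum>i\<in>UNIV. \<Sum>j\<in>UNIV. \<Sum>k\<in>UNIV. pd k (u t i) x * pd i (u t j) x * pd k (u t j) x))"
      unfolding eigenvalues3_symmetric_part(2)[OF ev[OF t] div[OF t]] ..
    also have "\<dots> = I (\<lambda>x. \<Sum>i\<in>UNIV. \<Sum>j\<in>UNIV. \<Sum>k\<in>UNIV. pd i (u t j) x * pd j (u t k) x * pd k (u t i) x) / 3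
           + I (\<lambda>x. \<Sum>i\<in>UNIV. \<Sum>j\<in>UNIV. \<Sum>k\<in>UNIV. pd k (u t i) x * pd i (u t j) x * pd k (u t j) x)"
      by (subst Bochner_Integration.integral_add)
         (auto intro!: cell_integrable_continuous continuous_intros c)
    also have "\<dots> = (\<Sum>i\<in>UNIV. \<Sum>j\<in>UNIV. \<Sum>k\<in>UNIV. I (\<lambda>x. pd i (u t j) x * pd j (u t k) x * pd k (u t i) x)) / 3
           + stretching (u t)"
      unfolding stretching_def[OF Q] by (simp add: I_sum_continuous c continuous_intros)
    finally show ?thesis unfolding trace_cubed_integral[OF Q] by simp
  qed
  have "((\<lambda>s. gradient_energy (u s)) has_real_derivative - stretching (u t)) (at t within {0..<T})"
    unfolding u by (rule gradient_energy_has_derivative[OF m euler t])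
  then have "((\<lambda>s. LINT x:cell L|lebesgue. (ev1 s x)\<^sup>2 + (ev2 s x)\<^sup>2 + (ev3 s x)\<^sup>2)
       has_real_derivative - stretching (u t)) (at t within {0..<T})"
    by (rule has_field_derivative_transform_within[where d=1]) (use t square in auto)
  then show "((\<lambda>s. LINT x:cell L|lebesgue. (ev1 s x)\<^sup>2 + (ev2 s x)\<^sup>2 + (ev3 s x)\<^sup>2)
       has_real_derivative
       - 4 * (LINT x:cell L|lebesgue. ev1 t x * ev2 t x * ev3 t x)) (at t within {0..<T})"
    using product by simp
qed

end
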